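(* For every $x>0$, $$x\sum_{n\ge1}d_2(n)\,n\,K_1(2xn\sqrt{\pi})=\frac{1}{4\sqrt{\pi}}\int_{0}^{\infty}P(X_1\le y)\left(\sum_{n\ge1}e^{-(xny)^2}\right)dy.$$
   Context: $d_2(n)$ is the number of ways of writing $n$ as an ordered product of $2$ positive integer factors (the number of divisors of $n$), and $K_1$ is the modified Bessel function of the second kind of order $1$. $X_1$ is a random variable on $(0,\infty)$ with density function $\frac{1}{x}v_1(x)$, where, for $x>0$ and real $c>1$, $$v_1(x):=\frac{\partial}{\partial x}\left(x^2\frac{\partial}{\partial x}w_1(x)\right),\qquad w_1(x):=\frac{1}{2\pi i}\int_{(c)}\Gamma\left(\tfrac{s}{2}\right)\zeta(s)\pi^{-s/2}x^{-s}\,ds,$$ $\zeta$ is the Riemann zeta function, and $\int_{(c)}$ denotes integration along the vertical line $\Re(s)=c$. *)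

theory Defs
  imports "HOL-Probability.Probability"
begin

text \<open>
  The number of ordered factorisations of \<open>n\<close> into two positive integers.
\<close>
definition d2 :: "nat \<Rightarrow> nat" where
  "d2 n = card {(a, b). 0 < a \<and> 0 < b \<and> a * b = n}"

text \<open>
  Modified Bessel function of the second kind, of real order \<open>\<nu>\<close> and for argument \<open>x > 0\<close>,
  defined by the classical absolutely convergent integral
  \<open>K\<^sub>\<nu>(x) = \<integral>\<^sub>0\<^sup>\<infinity> exp (- x cosh t) cosh (\<nu> t) dt\<close>.  For \<open>x \<le> 0\<close> the value is meaningless.
\<close>
definition bessel_K :: "real \<Rightarrow> real \<Rightarrow> real" where
  "bessel_K \<nu> x = (LBINT t:{0<..}. exp (- x * cosh t) * cosh (\<nu> * t))"

text \<open>
  The Riemann zeta function by its Dirichlet series.  The series gives zeta only on the half-plane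
  \<open>Re s > 1\<close>, which contains every line on which it is evaluated below.
\<close>
definition zeta :: "complex \<Rightarrow> complex" where
  "zeta s = (\<Sum>n. of_nat (Suc n) powr (- s))"

text \<open>
  The integral along the upward vertical line \<open>Re s = c\<close>, parametrised by \<open>s = c + \<i>t\<close>;
  the factor \<open>\<i>\<close> is \<open>ds/dt\<close>.
\<close>
definition vertical_line_integral :: "real \<Rightarrow> (complex \<Rightarrow> complex) \<Rightarrow> complex" where
  "vertical_line_integral c f = (LBINT t. f (Complex c t) * \<i>)"

definition w1 :: "real \<Rightarrow> real \<Rightarrow> complex" where
  "w1 c x = 1 / (2 * of_real pi * \<i>) *
     vertical_line_integral c
       (\<lambda>s. Gamma (s / 2) * zeta s * of_real pi powr (- s / 2) * of_real x powr (- s))"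

definition v1 :: "real \<Rightarrow> real \<Rightarrow> complex" where
  "v1 c x = vector_derivative
     (\<lambda>y. of_real (y\<^sup>2) * vector_derivative (w1 c) (at y)) (at x)"

text \<open>
  The density \<open>v\<^sub>1(x)/x\<close> on \<open>(0,\<infinity>)\<close>.  For \<open>x > 0\<close> and \<open>c > 1\<close> the complex number \<open>v1 c x\<close> is in fact
  real and nonnegative, so that neither \<^const>\<open>Re\<close> nor \<^const>\<open>ennreal\<close> loses information.
\<close>
definition X1_density :: "real \<Rightarrow> real \<Rightarrow> ennreal" where
  "X1_density c x = (if x > 0 then ennreal (1 / x * Re (v1 c x)) else 0)"

end

theory Submission
  imports Defs "HOL-Real_Asymp.Real_Asymp"
begin

text \<open>
  Mellin inversion of \<open>\<Gamma>\<close> gives \<open>w\<^sub>1(x) = 2 \<Sum>\<^sub>n exp (- \<pi> n\<^sup>2 x\<^sup>2)\<close>, so that \<open>v\<^sub>1(x)/x\<close> is the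
  derivative of \<open>F(x) = (x \<theta>(x))'\<close> with \<open>\<theta> = 1 + w\<^sub>1\<close>.  The functional equation
  \<open>x \<theta>(x) = \<theta>(1/x)\<close> turns this into \<open>F(y) = 4 \<pi> y\<^sup>-\<^sup>3 \<Sum>\<^sub>n n\<^sup>2 exp (- \<pi> n\<^sup>2 / y\<^sup>2)\<close>; the first
  form of \<open>F\<close> shows \<open>F(\<infinity>) = 1\<close>, and the two together show that the density is nonnegative, hence
  \<open>P(X\<^sub>1 \<le> y) = F(y)\<close>.  Integrating the second form against \<open>\<Sum>\<^sub>m exp (- (x m y)\<^sup>2)\<close> term by term
  produces the values \<open>K\<^sub>1(2 x m n \<surd>\<pi>)\<close>, and collecting the terms with the same product \<open>m n\<close>
  produces the divisor function.
\<close>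

section \<open>The substitution by the exponential function\<close>

text \<open>Inversion for \<open>Gamma\<close> is Fourier inversion in disguise: under
  \<open>x = exp u\<close> the value at \<open>a + i t\<close> is the Fourier transform of
  \<open>exp (a * u - exp u)\<close>, a bounded continuous function, and quadratic decay on vertical
  lines makes the inverse integral absolutely convergent. The functional equation is Poisson
  summation for a Gaussian. The Fourier series of the Dirac comb diverges, so it is given Abel
  weights \<open>r ^ k\<close>, which turn it into the Poisson kernel; the integral of the Gaussian
  against this kernel has a limit as \<open>r\<close> tends to 1 that can be evaluated in two ways.
  The distribution function is read off from the upper tail, so only the limit of F at infinity
  enters and its behaviour at 0 need not be studied. In the final computation all summands are
  nonnegative: sums and integrals are exchanged in \<open>ennreal\<close>, and integrability comes
  out together with the value.\<close>

lemma nn_integral_exp_substitution: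
  fixes f :: "real \<Rightarrow> ennreal"
  assumes [measurable]: "f \<in> borel_measurable borel"
  shows "(\<integral>\<^sup>+x\<in>{0<..}. f x \<partial>lborel) = (\<integral>\<^sup>+t. f (exp t) * ennreal (exp t) \<partial>lborel)"
proof -
  let ?J = "\<lambda>n. {exp (- real (Suc n))..exp (real (Suc n))}" and ?I = "\<lambda>n. {- real (Suc n)..real (Suc n)}"
  have eq: "(\<integral>\<^sup>+x\<in>?J n. f x \<partial>lborel) = (\<integral>\<^sup>+t\<in>?I n. f (exp t) * ennreal (exp t) \<partial>lborel)" for n
    by (intro nn_integral_substitution_aux) (auto intro!: continuous_intros derivative_eq_intros)
  have ex: "\<exists>n. \<bar>x\<bar> \<le> real (Suc n)" for x :: real
    by (meson le_SucI of_nat_le_iff order_trans real_arch_simple)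
  have UJ: "(\<Union>n. ?J n) = {0<..}"
  proof (intro equalityI subsetI)
    fix x :: real assume "x \<in> {0<..}"
    moreover obtain n where "\<bar>ln x\<bar> \<le> real (Suc n)" using ex by blast
    ultimately have "- real (Suc n) \<le> ln x" "ln x \<le> real (Suc n)" "0 < x" by auto
    hence "x \<in> ?J n" by (metis atLeastAtMost_iff exp_le_cancel_iff exp_ln)
    thus "x \<in> (\<Union>n. ?J n)" by blast
  qed (auto intro: less_le_trans[OF exp_gt_zero])
  have UI: "(\<Union>n. ?I n) = UNIV"
  proof (intro equalityI subsetI UNIV_I)
    fix x :: real
    obtain n where "\<bar>x\<bar> \<le> real (Suc n)" using ex by blast
    hence "x \<in> ?I n" by auto
    thus "x \<in> (\<Union>n. ?I n)" by blast
  qed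
  \<comment> \<open>Continuity from below of the measure with density \<open>h\<close> carries the
    compact case over to the union.\<close>
  have sup: "(\<integral>\<^sup>+x\<in>(\<Union>n. A n). h x \<partial>lborel) = (SUP n. \<integral>\<^sup>+x\<in>A n. h x \<partial>lborel)"
    if [measurable]: "h \<in> borel_measurable borel" "\<And>n. A n \<in> sets borel" and "incseq A"
    for h :: "real \<Rightarrow> ennreal" and A :: "nat \<Rightarrow> real set"
  proof -
    have "emeasure (density lborel h) (\<Union>n. A n) = (SUP n. emeasure (density lborel h) (A n))"
      using that by (intro SUP_emeasure_incseq [symmetric]) auto
    thus ?thesis by (simp add: emeasure_density)
  qed
  have "(\<integral>\<^sup>+x\<in>{0<..}. f x \<partial>lborel) = (SUP n. \<integral>\<^sup>+x\<in>?J n. f x \<partial>lborel)"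
    unfolding UJ [symmetric] by (intro sup) (auto simp: incseq_def)
  also have "\<dots> = (\<integral>\<^sup>+t\<in>UNIV. f (exp t) * ennreal (exp t) \<partial>lborel)"
    unfolding eq UI [symmetric] by (intro sup [symmetric]) (auto simp: incseq_def)
  finally show ?thesis by simp
qed

text \<open>As an identity of measures the substitution passes to Bochner integrals with values in
  any Banach space, through the rules for \<open>density\<close> and \<open>distr\<close>.\<close>

lemma lborel_exp_substitution:
  "density lborel (\<lambda>x. ennreal (indicator {0<..} x)) =
     distr (density lborel (\<lambda>t. ennreal (exp t))) borel (exp :: real \<Rightarrow> real)"
proof (rule measure_eqI)
  fix A :: "real set" assume "A \<in> sets (density lborel (\<lambda>x. ennreal (indicator {0<..} x)))"
  hence [measurable]: "A \<in> sets borel" by simp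
  have "emeasure (density lborel (\<lambda>x. ennreal (indicator {0<..} x))) A =
     (\<integral>\<^sup>+x\<in>{0<..}. indicator A x \<partial>lborel)"
    by (simp add: emeasure_density ennreal_indicator mult.commute)
  also have "\<dots> = (\<integral>\<^sup>+t. indicator A (exp t) * ennreal (exp t) \<partial>lborel)"
    by (intro nn_integral_exp_substitution) auto
  also have "\<dots> = emeasure (distr (density lborel (\<lambda>t. ennreal (exp t))) borel exp) A"
    by (subst emeasure_distr, simp, simp, subst emeasure_density)
       (auto intro!: nn_integral_cong measurable_sets_borel[of exp borel, simplified] simp: indicator_def)
  finally show "emeasure (density lborel (\<lambda>x. ennreal (indicator {0<..} x))) A =
     emeasure (distr (density lborel (\<lambda>t. ennreal (exp t))) borel exp) A" .
qed simp

lemma set_integral_exp_substitution: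
  fixes f :: "real \<Rightarrow> 'b :: {banach, second_countable_topology}"
  assumes [measurable]: "f \<in> borel_measurable borel"
  shows "set_integrable lborel {0<..} f \<longleftrightarrow> integrable lborel (\<lambda>t. exp t *\<^sub>R f (exp t))"
    and "(LBINT x:{0<..}. f x) = (LBINT t. exp t *\<^sub>R f (exp t))"
proof -
  let ?D = "density lborel (\<lambda>x. ennreal (indicator {0<..} x :: real))"
  have "set_integrable lborel {0<..} f \<longleftrightarrow> integrable ?D f"
    unfolding set_integrable_def by (subst integrable_density) auto
  thus "set_integrable lborel {0<..} f \<longleftrightarrow> integrable lborel (\<lambda>t. exp t *\<^sub>R f (exp t))"
    unfolding lborel_exp_substitution by (simp add: integrable_distr_eq integrable_density)
  have "(LBINT x:{0<..}. f x) = integral\<^sup>L ?D f"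
    unfolding set_lebesgue_integral_def by (subst integral_density) auto
  thus "(LBINT x:{0<..}. f x) = (LBINT t. exp t *\<^sub>R f (exp t))"
    unfolding lborel_exp_substitution by (simp add: integral_distr integral_density)
qed

section \<open>Mellin inversion of the Gamma function\<close>

text \<open>Euler's integral after the substitution \<open>x = exp u\<close>. For
  \<open>z = a + i t\<close> it exhibits \<open>Gamma\<close> on a vertical line as a Fourier
  transform in \<open>t\<close>.\<close>

lemma Gamma_exp_integral:
  assumes "Re z > 0"
  shows "integrable lborel (\<lambda>u. exp (z * of_real u - of_real (exp u)))"
    and "(CLBINT u. exp (z * of_real u - of_real (exp u))) = Gamma z"
proof -
  \<comment> \<open>Writing the power with \<open>ln\<close> makes \<open>f\<close> Borel measurable
    on the whole line; it is Euler's integrand only for \<open>t > 0\<close>.\<close>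
  define f where "f = (\<lambda>t. exp ((z - 1) * of_real (ln t)) * complex_of_real (exp (- t)))"
  have f_eq: "complex_of_real t powr (z - 1) / of_real (exp t) = f t" if "t \<in> {0<..}" for t
    using that by (simp add: f_def powr_def Ln_of_real exp_minus field_simps)
  have [measurable]: "f \<in> borel_measurable borel"
    unfolding f_def by measurable
  have eq: "exp t *\<^sub>R f (exp t) = exp (z * of_real t - of_real (exp t))" for t
  proof -
    have "exp t *\<^sub>R f (exp t) = exp (of_real t) * (exp ((z - 1) * of_real t) * exp (- of_real (exp t)))"
      unfolding f_def by (simp add: scaleR_conv_of_real flip: exp_of_real)
    thus ?thesis
      by (simp add: exp_add [symmetric] algebra_simps)
  qed
  have "f absolutely_integrable_on {0<..}"
    using absolutely_integrable_Gamma_integral'[OF assms]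
    by (subst set_integrable_cong[OF refl refl f_eq [symmetric]])
  \<comment> \<open>Absolute integrability refers to Lebesgue measure; Borel measurability of
    \<open>f\<close> brings it down to \<open>lborel\<close>.\<close>
  hence int: "set_integrable lborel {0<..} f"
    by (simp add: set_integrable_def integrable_completion)
  have "(f has_integral Gamma z) {0<..}"
    using has_integral_eq[OF f_eq Gamma_integral_complex'[OF assms]] .
  hence "(LBINT x:{0<..}. f x) = Gamma z"
    using set_borel_integral_eq_integral(2)[OF int] by (simp add: integral_unique)
  thus "(CLBINT u. exp (z * of_real u - of_real (exp u))) = Gamma z"
    by (simp add: set_integral_exp_substitution eq)
  show "integrable lborel (\<lambda>u. exp (z * of_real u - of_real (exp u)))"
    using int by (simp add: set_integral_exp_substitution eq)
qed

text \<open>The modulus of the integrand is the integrand at \<open>Re z\<close>.\<close>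

lemma norm_Gamma_le:
  assumes "Re z > 0"
  shows "norm (Gamma z) \<le> Gamma (Re z)"
proof -
  have "norm (Gamma z) \<le> (LBINT u. norm (exp (z * of_real u - of_real (exp u))))"
    unfolding Gamma_exp_integral(2)[OF assms, symmetric] by (rule integral_norm_bound)
  also have "\<dots> = Gamma (Re z)"
  proof -
    have "complex_of_real (LBINT u. norm (exp (z * of_real u - of_real (exp u)))) =
        (CLBINT u. exp (of_real (Re z) * of_real u - of_real (exp u)))"
      by (subst integral_complex_of_real [symmetric]) (simp add: norm_exp_eq_Re flip: exp_of_real)
    also have "\<dots> = of_real (Gamma (Re z))"
      using assms by (subst Gamma_exp_integral) (simp_all add: Gamma_complex_of_real)
    finally show ?thesis by (simp only: of_real_eq_iff)
  qed
  finally show ?thesis .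
qed

text \<open>
  Two steps of the recurrence give quadratic decay, enough for integrability without Stirling's formula.
\<close>
lemma norm_Gamma_vertical_le:
  assumes "a > 0"
  shows "norm (Gamma (Complex a t)) \<le> Gamma (a + 2) / (a\<^sup>2 + t\<^sup>2)"
proof -
  define z where "z = Complex a t"
  have [simp]: "Re z = a" by (simp add: z_def)
  have nz: "w \<notin> \<int>\<^sub>\<le>\<^sub>0" if "Re w > 0" for w
    using that by (auto elim!: nonpos_Ints_cases)
  have "Gamma (z + 1 + 1) = (z + 1) * (z * Gamma z)"
    using assms nz by (subst Gamma_plus1, simp, subst Gamma_plus1, auto)
  hence "norm (z + 1) * norm z * norm (Gamma z) = norm (Gamma (z + 2))"
    by (simp add: add.assoc mult.assoc flip: norm_mult)
  also have "\<dots> \<le> Gamma (a + 2)"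
    using norm_Gamma_le[of "z + 2"] assms by simp
  finally have *: "norm (z + 1) * norm z * norm (Gamma z) \<le> Gamma (a + 2)" .
  have "norm z \<le> norm (z + 1)"
    using assms by (simp add: cmod_def z_def power2_eq_square algebra_simps)
  hence "norm z ^ 2 * norm (Gamma z) \<le> norm (z + 1) * norm z * norm (Gamma z)"
    by (simp add: power2_eq_square mult_right_mono)
  also note *
  also have "norm z ^ 2 = a\<^sup>2 + t\<^sup>2"
    by (simp add: z_def cmod_def)
  finally have "(a\<^sup>2 + t\<^sup>2) * norm (Gamma z) \<le> Gamma (a + 2)" .
  moreover have "a\<^sup>2 + t\<^sup>2 > 0" using assms by (simp add: add_pos_nonneg)
  ultimately show ?thesis by (simp add: z_def field_simps)
qed

lemma integrable_inverse_sum_squares: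
  assumes "a \<noteq> 0"
  shows "integrable lborel (\<lambda>t::real. 1 / (a\<^sup>2 + t\<^sup>2))"
proof -
  have "integrable lborel (\<lambda>x::real. inverse (1 + x\<^sup>2))"
    using integrable_inverse_1_plus_square by (simp add: set_integrable_def)
  hence "integrable lborel (\<lambda>t. 1 / a\<^sup>2 * inverse (1 + (0 + 1 / a * t)\<^sup>2))"
    using assms by (intro integrable_mult_right lborel_integrable_real_affine) auto
  also have "(\<lambda>t. 1 / a\<^sup>2 * inverse (1 + (0 + 1 / a * t)\<^sup>2)) = (\<lambda>t. 1 / (a\<^sup>2 + t\<^sup>2))"
    using assms by (intro ext) (auto simp: field_simps add_nonneg_eq_0_iff)
  finally show ?thesis .
qed

lemma Gamma_vertical_measurable [measurable]:
  assumes "a > 0"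
  shows "(\<lambda>t. Gamma (Complex a t)) \<in> borel_measurable borel"
proof -
  have "continuous_on UNIV (\<lambda>t. Gamma (Complex a t))"
  proof (rule continuous_on_compose2[OF continuous_on_Gamma])
    show "range (Complex a) \<inter> \<int>\<^sub>\<le>\<^sub>0 = {}"
      using assms by (auto elim!: nonpos_Ints_cases simp: complex_eq_iff)
    show "continuous_on UNIV (Complex a)"
      unfolding Complex_eq by (intro continuous_intros)
  qed auto
  thus ?thesis by (rule borel_measurable_continuous_onI)
qed

lemma integrable_Gamma_vertical:
  assumes "a > 0"
  shows "integrable lborel (\<lambda>t. Gamma (Complex a t))"
proof (rule Bochner_Integration.integrable_bound)
  show "integrable lborel (\<lambda>t. Gamma (a + 2) * (1 / (a\<^sup>2 + t\<^sup>2)))"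
    using assms by (intro integrable_mult_right integrable_inverse_sum_squares) auto
  show "AE t in lborel. norm (Gamma (Complex a t)) \<le> norm (Gamma (a + 2) * (1 / (a\<^sup>2 + t\<^sup>2)))"
    using norm_Gamma_vertical_le[OF assms] assms by (intro always_eventually) (auto intro: order_trans[OF _ abs_ge_self])
qed (use assms in auto)

section \<open>Fourier inversion on the real line\<close>

text \<open>This is the characteristic function of the standard normal distribution at
  \<open>y / \<sigma>\<close>, after rescaling the variable by \<open>\<sigma>\<close>.\<close>

lemma gaussian_fourier_integral:
  assumes "\<sigma> > 0"
  shows "integrable lborel (\<lambda>t. exp (- (\<sigma> * t)\<^sup>2 / 2))"
    and "(CLBINT t. iexp (t * y) * of_real (exp (- (\<sigma> * t)\<^sup>2 / 2))) =
           of_real (sqrt (2 * pi) / \<sigma> * exp (- (y / \<sigma>)\<^sup>2 / 2))"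
proof -
  have "integrable lborel (\<lambda>t. sqrt (2 * pi) * std_normal_density (0 + \<sigma> * t))"
    using assms by (intro integrable_mult_right lborel_integrable_real_affine) auto
  thus "integrable lborel (\<lambda>t. exp (- (\<sigma> * t)\<^sup>2 / 2))"
    by (simp add: std_normal_density_def)
  have "of_real (exp (- (y / \<sigma>)\<^sup>2 / 2)) = char std_normal_distribution (y / \<sigma>)"
    by (simp add: char_std_normal_distribution)
  also have "\<dots> = (CLBINT s. std_normal_density s *\<^sub>R iexp (y / \<sigma> * s))"
    unfolding char_def by (subst integral_density) auto
  also have "\<dots> = \<sigma> *\<^sub>R (CLBINT t. std_normal_density (0 + \<sigma> * t) *\<^sub>R iexp (y / \<sigma> * (0 + \<sigma> * t)))"
    using assms by (subst lborel_integral_real_affine[where c = \<sigma> and t = 0]) auto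
  also have "\<dots> = (\<sigma> / sqrt (2 * pi)) *\<^sub>R (CLBINT t. iexp (t * y) * of_real (exp (- (\<sigma> * t)\<^sup>2 / 2)))"
    using assms
    by (simp add: std_normal_density_def scaleR_conv_of_real mult_ac flip: integral_mult_right_zero)
  finally have "of_real (exp (- (y / \<sigma>)\<^sup>2 / 2)) =
     (\<sigma> / sqrt (2 * pi)) *\<^sub>R (CLBINT t. iexp (t * y) * of_real (exp (- (\<sigma> * t)\<^sup>2 / 2)))" .
  thus "(CLBINT t. iexp (t * y) * of_real (exp (- (\<sigma> * t)\<^sup>2 / 2))) =
           of_real (sqrt (2 * pi) / \<sigma> * exp (- (y / \<sigma>)\<^sup>2 / 2))"
    using assms by (simp add: scaleR_conv_of_real field_simps)
qed

text \<open>
  With a Gaussian damping factor Fubini applies and the inner integral is again Gaussian; Fourier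
  inversion is the limit \<open>\<sigma> \<rightarrow> 0\<close>.
\<close>
lemma fourier_inversion_damped:
  fixes g :: "real \<Rightarrow> complex"
  assumes g: "integrable lborel g" and "\<sigma> > 0"
  shows "(CLBINT t. (CLBINT u. g u * iexp (t * u)) * iexp (- (t * x)) * of_real (exp (- (\<sigma> * t)\<^sup>2 / 2))) =
    2 * pi * (CLBINT z. g (x + \<sigma> * z) * of_real (std_normal_density z))"
proof -
  define d where "d = (\<lambda>t. exp (- (\<sigma> * t)\<^sup>2 / 2))"
  have d_int: "integrable lborel d"
    unfolding d_def by (rule gaussian_fourier_integral[OF \<open>\<sigma> > 0\<close>])
  have [measurable]: "g \<in> borel_measurable borel" "d \<in> borel_measurable borel"
    using g d_int by auto
  define f where "f = (\<lambda>t u. g u * iexp (t * (u - x)) * of_real (d t))"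
  have int: "integrable (lborel \<Otimes>\<^sub>M lborel) (case_prod f)"
  proof (rule lborel_pair.Fubini_integrable)
    have "(LBINT u. norm (f t u)) = (LBINT u. norm (g u)) * d t" for t
      by (subst integral_mult_left_zero [symmetric]) (simp add: f_def norm_mult d_def)
    thus "integrable lborel (\<lambda>t. LBINT u. norm (case_prod f (t, u)))"
      using d_int by simp
    have "integrable lborel (f t)" for t
    proof (rule Bochner_Integration.integrable_bound)
      show "integrable lborel (\<lambda>u. g u * of_real (d t))" using g by simp
    qed (auto simp: f_def norm_mult)
    thus "AE t in lborel. integrable lborel (\<lambda>u. case_prod f (t, u))" by simp
  qed (unfold f_def, measurable)
  have "(CLBINT t. (CLBINT u. g u * iexp (t * u)) * iexp (- (t * x)) * of_real (d t)) =
      (CLBINT t. CLBINT u. f t u)"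
    by (intro Bochner_Integration.integral_cong refl, unfold f_def, 
        simp only: integral_mult_left_zero [symmetric])
       (auto intro!: Bochner_Integration.integral_cong simp: exp_add [symmetric] algebra_simps)
  also have "\<dots> = (CLBINT u. CLBINT t. f t u)"
    by (rule lborel_pair.Fubini_integral [OF int, symmetric])
  also have "\<dots> = (CLBINT u. g u * of_real (sqrt (2 * pi) / \<sigma> * exp (- ((u - x) / \<sigma>)\<^sup>2 / 2)))"
    unfolding f_def mult.assoc integral_mult_right_zero d_def
      gaussian_fourier_integral(2)[OF \<open>\<sigma> > 0\<close>] ..
  \<comment> \<open>The inner integral is a Gaussian of width \<open>\<sigma>\<close> around
    \<open>x\<close>. In the variable \<open>z\<close> it becomes the standard normal density, and
    \<open>sqrt (2 * pi)\<close> is \<open>2 * pi\<close> times its normalising constant.\<close>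
  also have "\<dots> = \<sigma> *\<^sub>R (CLBINT z. g (x + \<sigma> * z) * of_real (sqrt (2 * pi) / \<sigma> * exp (- ((x + \<sigma> * z - x) / \<sigma>)\<^sup>2 / 2)))"
    using assms by (subst lborel_integral_real_affine[where c = \<sigma> and t = x]) auto
  also have "\<dots> = (CLBINT z. 2 * pi * (g (x + \<sigma> * z) * of_real (std_normal_density z)))"
  proof (subst integral_scaleR_right [symmetric], intro Bochner_Integration.integral_cong refl)
    fix z
    have "2 * pi * std_normal_density z = \<sigma> * (sqrt (2 * pi) / \<sigma> * exp (- ((x + \<sigma> * z - x) / \<sigma>)\<^sup>2 / 2))"
      using \<open>\<sigma> > 0\<close> by (simp add: std_normal_density_def real_div_sqrt field_simps)
    hence "complex_of_real (2 * pi) * of_real (std_normal_density z) =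
        of_real \<sigma> * of_real (sqrt (2 * pi) / \<sigma> * exp (- ((x + \<sigma> * z - x) / \<sigma>)\<^sup>2 / 2))"
      by (metis of_real_mult)
    thus "\<sigma> *\<^sub>R (g (x + \<sigma> * z) * of_real (sqrt (2 * pi) / \<sigma> * exp (- ((x + \<sigma> * z - x) / \<sigma>)\<^sup>2 / 2))) =
      2 * pi * (g (x + \<sigma> * z) * of_real (std_normal_density z))"
      unfolding scaleR_conv_of_real by (simp only: mult.left_commute[of _ "g (x + \<sigma> * z)"])
  qed
  finally show ?thesis by (simp add: d_def)
qed

text \<open>Both sides of the damped identity converge by dominated convergence: the left under the
  majorant \<open>norm (G t)\<close>, the right under \<open>B\<close> times the normal density,
  where continuity of \<open>g\<close> at the single point \<open>x\<close> suffices.\<close>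

lemma fourier_inversion:
  fixes g :: "real \<Rightarrow> complex"
  assumes g: "integrable lborel g" and cont: "isCont g x" and bound: "\<And>u. norm (g u) \<le> B"
    and G: "integrable lborel (\<lambda>t. CLBINT u. g u * iexp (t * u))"
  shows "(CLBINT t. (CLBINT u. g u * iexp (t * u)) * iexp (- (t * x))) = 2 * pi * g x"
proof -
  define G where "G = (\<lambda>t. CLBINT u. g u * iexp (t * u))"
  have [measurable]: "g \<in> borel_measurable borel" "G \<in> borel_measurable borel"
    using g assms(4) by (auto simp: G_def)
  define s where "s = (\<lambda>n. inverse (real (Suc n)))"
  have s0: "s n > 0" for n by (simp add: s_def)
  have s_lim: "s \<longlonglongrightarrow> 0" unfolding s_def by (rule LIMSEQ_inverse_real_of_nat)
  have "(\<lambda>n. CLBINT t. G t * iexp (- (t * x)) * of_real (exp (- (s n * t)\<^sup>2 / 2))) \<longlonglongrightarrow>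
      (CLBINT t. G t * iexp (- (t * x)))"
  proof (rule integral_dominated_convergence[where w = "\<lambda>t. norm (G t)"])
    show "AE t in lborel. (\<lambda>n. G t * iexp (- (t * x)) * of_real (exp (- (s n * t)\<^sup>2 / 2)))
        \<longlonglongrightarrow> G t * iexp (- (t * x))"
    proof (intro always_eventually allI)
      fix t
      have "(\<lambda>n. G t * iexp (- (t * x)) * of_real (exp (- (s n * t)\<^sup>2 / 2)))
        \<longlonglongrightarrow> G t * iexp (- (t * x)) * of_real (exp (- (0 * t)\<^sup>2 / 2))"
        by (intro tendsto_intros s_lim) auto
      thus "(\<lambda>n. G t * iexp (- (t * x)) * of_real (exp (- (s n * t)\<^sup>2 / 2)))
        \<longlonglongrightarrow> G t * iexp (- (t * x))" by simp
    qed
    show "integrable lborel (\<lambda>t. norm (G t))" using assms(4) by (simp add: G_def)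
  qed (auto simp: norm_mult mult_left_le)
  moreover have "(CLBINT t. G t * iexp (- (t * x)) * of_real (exp (- (s n * t)\<^sup>2 / 2))) =
      2 * pi * (CLBINT z. g (x + s n * z) * of_real (std_normal_density z))" for n
    unfolding G_def by (rule fourier_inversion_damped[OF g s0])
  moreover have "(\<lambda>n. 2 * pi * (CLBINT z. g (x + s n * z) * of_real (std_normal_density z)))
     \<longlonglongrightarrow> 2 * pi * (CLBINT z. g x * of_real (std_normal_density z))"
  proof (intro tendsto_mult_left, 
         rule integral_dominated_convergence[where w = "\<lambda>z. B * std_normal_density z"])
    show "AE z in lborel. (\<lambda>n. g (x + s n * z) * of_real (std_normal_density z))
        \<longlonglongrightarrow> g x * of_real (std_normal_density z)"
    proof (intro always_eventually allI tendsto_mult_right)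
      fix z
      have "(\<lambda>n. x + s n * z) \<longlonglongrightarrow> x + 0 * z" by (intro tendsto_intros s_lim)
      thus "(\<lambda>n. g (x + s n * z)) \<longlonglongrightarrow> g x"
        using isCont_tendsto_compose[OF cont] by simp
    qed
    show "AE z in lborel. norm (g (x + s n * z) * of_real (std_normal_density z)) \<le> B * std_normal_density z" for n
      using bound by (auto simp: norm_mult intro!: mult_right_mono)
  qed auto
  moreover have "(CLBINT z. g x * of_real (std_normal_density z)) = g x"
    by (subst integral_mult_right_zero, subst integral_complex_of_real) simp
  ultimately have "(CLBINT t. G t * iexp (- (t * x))) = complex_of_real (2 * pi) * g x"
    by (simp only: LIMSEQ_unique)
  thus ?thesis by (simp add: G_def)
qed

section \<open>Inversion on a vertical line\<close>

text \<open>The concave function on the left has its maximum at \<open>u = ln a\<close>. This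
  supplies the uniform bound that Fourier inversion asks for.\<close>

lemma exp_linear_minus_exp_le:
  assumes "a > (0::real)"
  shows "a * u - exp u \<le> a * ln a - a"
proof -
  have "exp u = a * exp (u - ln a)" using assms by (simp add: exp_diff)
  also have "\<dots> \<ge> a * (1 + (u - ln a))"
    using assms by (intro mult_left_mono exp_ge_add_one_self) auto
  finally show ?thesis by (simp add: algebra_simps)
qed

text \<open>Since \<open>Y powr (- a - i t)\<close> is \<open>Y powr (- a)\<close> times the phase
  \<open>exp (- i t ln Y)\<close>, the integral is Fourier inversion of
  \<open>exp (a * u - exp u)\<close> at the point \<open>u = ln Y\<close>.\<close>

lemma inverse_mellin_Gamma:
  assumes "a > 0" "Y > 0"
  shows "(CLBINT t. Gamma (Complex a t) * of_real Y powr (- Complex a t)) = of_real (2 * pi * exp (- Y))"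
proof -
  define g where "g = (\<lambda>u. complex_of_real (exp (a * u - exp u)))"
  have g_eq: "g u * iexp (t * u) = exp (Complex a t * of_real u - of_real (exp u))" for t u
    unfolding g_def Complex_eq by (simp add: algebra_simps flip: exp_of_real exp_add)
  have G: "(CLBINT u. g u * iexp (t * u)) = Gamma (Complex a t)" for t
    unfolding g_eq using assms by (intro Gamma_exp_integral) simp
  have "g = (\<lambda>u. exp (Complex a 0 * of_real u - of_real (exp u)))"
    using g_eq[of _ 0] by auto
  hence g_int: "integrable lborel g"
    using assms by (simp only:) (intro Gamma_exp_integral; simp)
  have "(CLBINT t. Gamma (Complex a t) * iexp (- (t * ln Y))) = 2 * pi * g (ln Y)"
    unfolding G [symmetric]
  proof (rule fourier_inversion[OF g_int])
    show "isCont g (ln Y)" unfolding g_def by (intro continuous_intros)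
    show "norm (g u) \<le> exp (a * ln a - a)" for u
      unfolding g_def using exp_linear_minus_exp_le[OF assms(1)] by simp
    show "complex_integrable lborel (\<lambda>t. CLBINT u. g u * iexp (t * u))"
      unfolding G by (rule integrable_Gamma_vertical[OF assms(1)])
  qed
  moreover have "Gamma (Complex a t) * of_real Y powr (- Complex a t) =
      of_real (Y powr (- a)) * (Gamma (Complex a t) * iexp (- (t * ln Y)))" for t
    using assms by (simp add: powr_def Ln_of_real Complex_eq algebra_simps flip: exp_of_real exp_add)
  ultimately have "(CLBINT t. Gamma (Complex a t) * of_real Y powr (- Complex a t)) =
      of_real (Y powr (- a)) * (2 * pi * g (ln Y))"
    by (simp only: integral_mult_right_zero)
  also have "\<dots> = of_real (2 * pi * exp (- Y))"
  proof -
    have "Y powr (- a) * exp (a * ln Y - Y) = exp (- Y)"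
      using assms by (simp add: powr_def flip: exp_add)
    thus ?thesis using assms unfolding g_def by (simp add: mult.left_commute flip: of_real_mult)
  qed
  finally show ?thesis .
qed

section \<open>The theta series and its functional equation\<close>

text \<open>The index \<open>k\<close> counts differentiations in \<open>u\<close>, up to the sign
  \<open>(-1) ^ k\<close>. The function \<theta> of the overview is
  \<open>1 + 2 * theta_sum 0 (pi * x\<^sup>2)\<close>.\<close>

definition theta_sum :: "nat \<Rightarrow> real \<Rightarrow> real" where
  "theta_sum k u = (\<Sum>n. real (Suc n) ^ (2 * k) * exp (- (real (Suc n))\<^sup>2 * u))"

text \<open>Raise \<open>u / m \<le> exp (u / m)\<close> to the power \<open>m\<close>. At
  \<open>m = 0\<close> the right-hand side is \<open>0 ^ 0 = 1\<close>.\<close>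

lemma exp_minus_le_power:
  fixes u :: real
  assumes "u > 0"
  shows "exp (- u) \<le> (real m / u) ^ m"
proof (cases "m = 0")
  case False
  have "(u / real m) ^ m \<le> exp (u / real m) ^ m"
  proof (rule power_mono)
    show "u / real m \<le> exp (u / real m)"
      using exp_ge_add_one_self[of "u / real m"] by linarith
  qed (use assms in auto)
  also have "\<dots> = exp u"
    using False by (simp flip: exp_of_nat_mult)
  finally show ?thesis
    using assms False by (simp add: power_divide exp_minus field_simps)
qed (use assms in auto)

text \<open>The exponent \<open>Suc k\<close> cancels the factor \<open>n ^ (2 * k)\<close> and
  leaves one factor \<open>1 / n^2\<close> for convergence.\<close>

lemma theta_term_le:
  assumes "u > 0"
  shows "real (Suc n) ^ (2 * k) * exp (- (real (Suc n))\<^sup>2 * u) \<le> (real (Suc k) / u) ^ Suc k * (1 / (real (Suc n))\<^sup>2)"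
proof -
  define N where "N = (real (Suc n))\<^sup>2"
  have N: "N > 0" by (simp add: N_def)
  have "N ^ k * exp (- (N * u)) \<le> N ^ k * (real (Suc k) / (N * u)) ^ Suc k"
    using assms N by (intro mult_left_mono exp_minus_le_power) auto
  also have "\<dots> = (real (Suc k) / u) ^ Suc k * (1 / N)"
    using N by (simp add: power_divide power_mult_distrib del: of_nat_Suc)
  finally show ?thesis by (simp add: N_def power_mult)
qed

lemma theta_summable:
  assumes "u > 0"
  shows "summable (\<lambda>n. real (Suc n) ^ (2 * k) * exp (- (real (Suc n))\<^sup>2 * u))"
proof (rule summable_comparison_test')
  have "summable (\<lambda>n. 1 / (real (Suc n))\<^sup>2)"
    using inverse_squares_sums sums_summable by (simp add: add.commute)
  thus "summable (\<lambda>n. (real (Suc k) / u) ^ Suc k * (1 / (real (Suc n))\<^sup>2))"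
    by (rule summable_mult)
qed (use theta_term_le[OF assms] in auto)

lemma theta_sum_pos: "u > 0 \<Longrightarrow> theta_sum k u > 0"
  unfolding theta_sum_def by (intro suminf_pos theta_summable) auto

lemma theta_sum_has_derivative:
  assumes "u > 0"
  shows "(theta_sum k has_field_derivative - theta_sum (Suc k) u) (at u)"
proof -
  define f where "f = (\<lambda>k n u. real (Suc n) ^ (2 * k) * exp (- (real (Suc n))\<^sup>2 * u))"
  have sm: "summable (\<lambda>n. f k n v)" if "v > 0" for k v
    unfolding f_def by (rule theta_summable[OF that])
  have "((\<lambda>v. \<Sum>n. f k n v) has_field_derivative (\<Sum>n. - f (Suc k) n u)) (at u)"
  proof (rule has_field_derivative_series'(2))
    \<comment> \<open>On the half-line from \<open>u / 2\<close> the differentiated terms are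
      dominated by their values at \<open>u / 2\<close>, which keeps away from the singularity at
      0.\<close>
    show "(f k n has_field_derivative - f (Suc k) n v) (at v within {u/2<..})" for n v
      unfolding f_def by (auto intro!: derivative_eq_intros simp: power2_eq_square algebra_simps power_add)
    show "uniformly_convergent_on {u/2<..} (\<lambda>n v. \<Sum>i<n. - f (Suc k) i v)"
    proof (rule Weierstrass_m_test')
      show "norm (- f (Suc k) n v) \<le> f (Suc k) n (u/2)" if "v \<in> {u/2<..}" for n v
        using that by (auto simp: f_def intro!: mult_left_mono)
    qed (use assms sm in auto)
    show "u \<in> interior {u/2<..}" "u \<in> {u/2<..}" using assms by (auto simp: interior_open)
  qed (use assms sm in auto)
  also have "(\<Sum>n. - f (Suc k) n u) = - theta_sum (Suc k) u"
    unfolding theta_sum_def f_def by (rule suminf_minus) (rule theta_summable[OF assms])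
  finally show ?thesis by (simp add: theta_sum_def [abs_def] f_def)
qed

text \<open>For \<open>n \<ge> 1\<close> and \<open>u \<ge> 1\<close> both
  \<open>n^2 u \<ge> u\<close> and \<open>n^2 u \<ge> n^2\<close> hold; their average splits off the
  factor \<open>exp (- u / 2)\<close> and leaves a convergent series free of
  \<open>u\<close>.\<close>

lemma theta_sum_le_exp:
  assumes "u \<ge> 1"
  shows "theta_sum k u \<le> exp (- u / 2) * theta_sum k (1 / 2)"
proof -
  have "theta_sum k u \<le> (\<Sum>n. exp (- u / 2) * (real (Suc n) ^ (2 * k) * exp (- (real (Suc n))\<^sup>2 * (1 / 2))))"
    unfolding theta_sum_def
  proof (intro suminf_le theta_summable summable_mult)
    fix n
    define N where "N = (real (Suc n))\<^sup>2"
    have "1 \<le> N" unfolding N_def by (rule one_le_power) simp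
    with assms have "(N - 1) * u \<ge> 0" "N * u \<ge> N * 1" by (auto intro: mult_left_mono)
    hence "- N * u \<le> - u / 2 + - N * (1 / 2)" by (simp add: algebra_simps)
    hence "exp (- N * u) \<le> exp (- u / 2) * exp (- N * (1 / 2))" by (simp flip: exp_add)
    thus "real (Suc n) ^ (2 * k) * exp (- (real (Suc n))\<^sup>2 * u) \<le>
        exp (- u / 2) * (real (Suc n) ^ (2 * k) * exp (- (real (Suc n))\<^sup>2 * (1 / 2)))"
      unfolding N_def by (subst mult.left_commute, intro mult_left_mono) auto
  qed (use assms in auto)
  also have "\<dots> = exp (- u / 2) * theta_sum k (1 / 2)"
    unfolding theta_sum_def by (rule suminf_mult) (rule theta_summable, simp)
  finally show ?thesis .
qed

lemma theta_sum_tendsto_0: "((\<lambda>u. u ^ j * theta_sum k u) \<longlongrightarrow> 0) at_top"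
proof (rule tendsto_sandwich[where f = "\<lambda>_. 0"])
  have "((\<lambda>u::real. (u ^ j / exp (u / 2)) * theta_sum k (1 / 2)) \<longlongrightarrow> 0 * theta_sum k (1 / 2)) at_top"
    by (intro tendsto_intros) real_asymp
  thus "((\<lambda>u::real. (u ^ j / exp (u / 2)) * theta_sum k (1 / 2)) \<longlongrightarrow> 0) at_top" by simp
  show "\<forall>\<^sub>F u in at_top. u ^ j * theta_sum k u \<le> (u ^ j / exp (u / 2)) * theta_sum k (1 / 2)"
    using eventually_ge_at_top[of 1]
  proof eventually_elim
    case (elim u)
    hence "u ^ j * theta_sum k u \<le> u ^ j * (exp (- u / 2) * theta_sum k (1 / 2))"
      by (intro mult_left_mono theta_sum_le_exp) auto
    thus ?case by (simp add: exp_minus field_simps)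
  qed
  show "\<forall>\<^sub>F u in at_top. 0 \<le> u ^ j * theta_sum k u"
    using eventually_gt_at_top[of 0] by eventually_elim (auto intro!: less_imp_le theta_sum_pos mult_pos_pos)
qed simp

text \<open>
  This is \<open>(1 - r\<^sup>2) / |1 - r exp (2 \<pi> \<i> u)|\<^sup>2\<close>, the Poisson kernel rescaled to period 1.
\<close>
definition poisson_kernel :: "real \<Rightarrow> real \<Rightarrow> real" where
  "poisson_kernel r u = (1 - r\<^sup>2) / ((1 - r)\<^sup>2 + 4 * r * (sin (pi * u))\<^sup>2)"

section \<open>Fourier series, bounds and period integral of the Poisson kernel\<close>

lemma poisson_kernel_denominator_pos:
  assumes "0 \<le> r" "r < 1"
  shows "(1 - r)\<^sup>2 + 4 * r * (sin (pi * u))\<^sup>2 > 0"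
  using assms by (intro add_pos_nonneg) auto

text \<open>Take real parts in the geometric series for
  \<open>2 z / (1 - z) = (1 + z) / (1 - z) - 1\<close> at
  \<open>z = r exp (2 pi i u)\<close>.\<close>

lemma poisson_kernel_sums:
  assumes "0 \<le> r" "r < 1"
  shows "(\<lambda>k. 2 * r ^ Suc k * cos (2 * pi * real (Suc k) * u)) sums (poisson_kernel r u - 1)"
proof -
  define z where "z = of_real r * cis (2 * pi * u)"
  have nz: "norm z < 1" using assms by (simp add: z_def norm_mult)
  hence z1: "1 - z \<noteq> 0" by auto
  have "(\<lambda>k. z ^ k) sums (1 / (1 - z))" by (rule geometric_sums[OF nz])
  hence "(\<lambda>k. 2 * z * z ^ k) sums (2 * z * (1 / (1 - z)))" by (rule sums_mult)
  hence "(\<lambda>k. Re (2 * z * z ^ k)) sums Re (2 * z * (1 / (1 - z)))" by (rule sums_Re)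
  moreover have "Re (2 * z * z ^ k) = 2 * r ^ Suc k * cos (2 * pi * real (Suc k) * u)" for k
  proof -
    have "2 * z * z ^ k = of_real (2 * r ^ Suc k) * cis (real (Suc k) * (2 * pi * u))"
      unfolding Complex.DeMoivre [symmetric] by (simp add: z_def power_mult_distrib mult_ac)
    hence "Re (2 * z * z ^ k) = Re (of_real (2 * r ^ Suc k) * cis (real (Suc k) * (2 * pi * u)))"
      by (simp only:)
    thus ?thesis by (simp add: mult_ac)
  qed
  moreover have "Re (2 * z * (1 / (1 - z))) = poisson_kernel r u - 1"
  proof -
    define C where "C = cos (2 * pi * u)"
    define S where "S = sin (2 * pi * u)"
    have CS: "C\<^sup>2 + S\<^sup>2 = 1" by (simp add: C_def S_def)
    have cos_eq: "C = 1 - 2 * (sin (pi * u))\<^sup>2"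
      using cos_double_sin[of "pi * u"] by (simp add: C_def mult_ac)
    have rez: "Re z = r * C" "Im z = r * S" by (simp_all add: z_def C_def S_def)
    have nsq: "(cmod (1 - z))\<^sup>2 = (1 - r)\<^sup>2 + 4 * r * (sin (pi * u))\<^sup>2"
    proof -
      have "(cmod (1 - z))\<^sup>2 = 1 - 2 * r * C + r\<^sup>2 * (C\<^sup>2 + S\<^sup>2)"
        unfolding cmod_power2 by (simp add: rez power2_eq_square algebra_simps)
      thus ?thesis unfolding CS by (simp add: cos_eq power2_eq_square algebra_simps)
    qed
    have "2 * z * (1 / (1 - z)) = (1 + z) / (1 - z) - 1"
      using z1 by (simp add: field_simps)
    also have "Re \<dots> = Re ((1 + z) * cnj (1 - z)) / (cmod (1 - z))\<^sup>2 - 1"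
      by (subst complex_div_cnj) (simp flip: of_real_power)
    also have "Re ((1 + z) * cnj (1 - z)) = 1 - r\<^sup>2 * (C\<^sup>2 + S\<^sup>2)"
      by (simp add: rez power2_eq_square algebra_simps)
    finally show ?thesis by (simp add: nsq CS poisson_kernel_def)
  qed
  ultimately show ?thesis by simp
qed

text \<open>Sine is concave on \<open>[0, pi / 2]\<close>, so its graph lies above the
  chord.\<close>

lemma jordan_sin_le:
  assumes "0 \<le> d" "d \<le> 1 / 2"
  shows "2 * d \<le> sin (pi * d)"
proof -
  have "concave_on {0..pi/2} sin"
  proof (rule f''_le0_imp_concave)
    show "- sin x \<le> 0" if "x \<in> {0..pi/2}" for x
      using that by (auto intro!: sin_ge_zero)
  qed (auto intro!: derivative_eq_intros)
  from concave_onD[OF this, of "2 * d" 0 "pi / 2"] assms show ?thesis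
    by (simp add: mult_ac)
qed

lemma sin_pi_minus_round:
  fixes u :: real
  shows "(sin (pi * u))\<^sup>2 = (sin (pi * \<bar>u - of_int (round u)\<bar>))\<^sup>2"
proof -
  have "sin (pi * (u - of_int n)) = sin (pi * u) * cos (pi * of_int n)" for n :: int
    by (simp add: right_diff_distrib sin_diff)
  moreover have "(cos (pi * of_int n))\<^sup>2 = 1" for n :: int
    using sin_cos_squared_add[of "pi * of_int n"] by simp
  moreover have "(sin (pi * \<bar>v\<bar>))\<^sup>2 = (sin (pi * v))\<^sup>2" for v
    by (cases "v \<ge> 0") auto
  ultimately show ?thesis by (simp add: power_mult_distrib)
qed

lemma poisson_kernel_nonneg: "0 \<le> r \<Longrightarrow> r < 1 \<Longrightarrow> 0 \<le> poisson_kernel r u"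
  unfolding poisson_kernel_def
  by (intro divide_nonneg_nonneg less_imp_le[OF poisson_kernel_denominator_pos]) (auto simp: power_le_one)

text \<open>Let \<open>d\<close> be the distance to the nearest integer. Jordan's inequality and
  \<open>r \<ge> 1 / 2\<close> give \<open>4 r sin^2 \<ge> (2 d)^2\<close>, so by the inequality of
  means the denominator is at least \<open>4 (1 - r) d\<close>, which is at least
  \<open>2 d (1 - r^2)\<close>.\<close>

lemma poisson_kernel_le:
  assumes "1 / 2 \<le> r" "r < 1"
  shows "\<bar>u - of_int (round u)\<bar> * poisson_kernel r u \<le> 1 / 2"
proof -
  define d where "d = \<bar>u - of_int (round u)\<bar>"
  have d: "0 \<le> d" "d \<le> 1 / 2"
    using of_int_round_abs_le[of u] by (auto simp: d_def abs_minus_commute)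
  have "(2 * d)\<^sup>2 \<le> (sin (pi * u))\<^sup>2"
    unfolding sin_pi_minus_round[of u] d_def [symmetric] using d by (intro power_mono jordan_sin_le) auto
  hence "2 * (2 * d)\<^sup>2 \<le> 4 * r * (sin (pi * u))\<^sup>2"
    using assms by (intro mult_mono) auto
  moreover have "0 \<le> ((1 - r) - 2 * d)\<^sup>2" by simp
  hence "4 * (1 - r) * d \<le> (1 - r)\<^sup>2 + (2 * d)\<^sup>2"
    by (simp add: power2_eq_square algebra_simps)
  ultimately have "4 * (1 - r) * d \<le> (1 - r)\<^sup>2 + 4 * r * (sin (pi * u))\<^sup>2"
    using zero_le_power2[of "2 * d"] by linarith
  moreover have "2 * d * (1 - r\<^sup>2) \<le> 4 * (1 - r) * d"
  proof -
    have "2 * d * (1 - r\<^sup>2) = (2 * d * (1 - r)) * (1 + r)" by (simp add: power2_eq_square algebra_simps)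
    also have "\<dots> \<le> (2 * d * (1 - r)) * 2" using assms d by (intro mult_left_mono) auto
    also have "\<dots> = 4 * (1 - r) * d" by simp
    finally show ?thesis .
  qed
  ultimately have "2 * (d * (1 - r\<^sup>2)) \<le> (1 - r)\<^sup>2 + 4 * r * (sin (pi * u))\<^sup>2" by linarith
  thus ?thesis
    using poisson_kernel_denominator_pos[of r u] assms
    by (simp add: poisson_kernel_def d_def [symmetric] field_simps)
qed

lemma poisson_kernel_measurable [measurable]: "poisson_kernel r \<in> borel_measurable borel"
  unfolding poisson_kernel_def [abs_def] by measurable

text \<open>Every cosine in the series integrates to 0 over a period, so only the constant term 1
  survives. The majorants \<open>2 * r ^ Suc k\<close> justify integrating term by term.\<close>

lemma poisson_kernel_period_integral:
  assumes "0 \<le> r" "r < 1"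
  shows "set_integrable lborel {a..<a + 1} (poisson_kernel r)"
    and "(LBINT u:{a..<a + 1}. poisson_kernel r u) = 1"
proof -
  define f where "f = (\<lambda>k u. 2 * r ^ Suc k * cos (2 * pi * real (Suc k) * u))"
  have [measurable]: "f k \<in> borel_measurable borel" for k unfolding f_def by measurable
  \<comment> \<open>Half-open periods are needed to tile the line, closed ones for the fundamental
    theorem of calculus; they differ by a null set.\<close>
  have AE: "AE u in lborel. u \<in> {a..<a + 1} \<longleftrightarrow> u \<in> {a..a + 1}"
    using AE_lborel_singleton[of "a + 1"] by eventually_elim auto
  have f_int: "set_integrable lborel {a..a + 1} (f k)" for k
    unfolding f_def by (intro borel_integrable_atLeastAtMost' continuous_intros)
  have f0: "(LBINT u:{a..a + 1}. f k u) = 0" for k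
  proof -
    define F where "F = (\<lambda>u. 2 * r ^ Suc k * (sin (2 * pi * real (Suc k) * u) / (2 * pi * real (Suc k))))"
    have "(LBINT u:{a..a + 1}. f k u) = F (a + 1) - F a"
      unfolding set_lebesgue_integral_def real_scaleR_def
    proof (rule integral_FTC_Icc_real[where F = F, unfolded mult.commute[of _ "indicator _ _"]])
      show "(F has_real_derivative f k u) (at u)" for u
        unfolding F_def f_def by (auto intro!: derivative_eq_intros simp del: of_nat_Suc)
      show "isCont (f k) u" for u unfolding f_def by (intro continuous_intros)
    qed simp
    also have "F (a + 1) = F a"
    proof -
      have "sin (2 * pi * real (Suc k) * (a + 1)) = sin (2 * pi * real (Suc k) * a + 2 * real (Suc k) * pi)"
        by (simp add: algebra_simps)
      also have "\<dots> = sin (2 * pi * real (Suc k) * a)"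
        unfolding sin_add cos_2npi sin_2npi by simp
      finally show ?thesis by (simp add: F_def)
    qed
    finally show ?thesis by simp
  qed
  let ?g = "\<lambda>k u. indicator {a..a + 1} u *\<^sub>R f k u"
  have norm_le: "norm (?g k u) \<le> 2 * r ^ Suc k * indicator {a..a + 1} u" for k u
    using assms by (auto simp: f_def abs_mult indicator_def mult_left_le simp del: of_nat_Suc power_Suc)
  have sm: "summable (\<lambda>k. 2 * r ^ Suc k * c)" for c
    using assms by (intro summable_mult summable_mult2 summable_geometric summable_Suc_iff[THEN iffD2]) auto
  have ptw: "(\<lambda>k. ?g k u) sums (indicator {a..a + 1} u *\<^sub>R (poisson_kernel r u - 1))" for u
    unfolding f_def by (intro sums_scaleR_right poisson_kernel_sums assms)
  have 1: "\<And>k. integrable lborel (?g k)" using f_int by (simp add: set_integrable_def)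
  have 2: "AE u in lborel. summable (\<lambda>k. norm (?g k u))"
  proof (intro always_eventually allI)
    fix u
    have "norm (norm (?g k u)) \<le> 2 * r ^ Suc k * indicator {a..a + 1} u" for k
      using norm_le[of u k] by (simp only: real_norm_def abs_abs)
    thus "summable (\<lambda>k. norm (?g k u))"
      by (intro summable_comparison_test'[OF sm])
  qed
  have 3: "summable (\<lambda>k. LBINT u. norm (?g k u))"
  proof (rule summable_comparison_test'[OF sm])
    fix k
    have "(LBINT u. norm (?g k u)) \<le> (LBINT u. 2 * r ^ Suc k * indicator {a..a + 1} u)"
      using 1 norm_le by (intro integral_mono integrable_norm) auto
    thus "norm (LBINT u. norm (?g k u)) \<le> 2 * r ^ Suc k * 1" by simp
  qed
  have "integrable lborel (\<lambda>u. indicator {a..a + 1} u *\<^sub>R (poisson_kernel r u - 1))"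
    using integrable_suminf[OF 1 2 3] by (simp only: sums_unique[OF ptw, symmetric])
  moreover have "(LBINT u. indicator {a..a + 1} u *\<^sub>R (poisson_kernel r u - 1)) = 0"
    using integral_suminf[OF 1 2 3] f0
    by (simp only: sums_unique[OF ptw, symmetric]) (simp add: set_lebesgue_integral_def)
  ultimately have *: "has_bochner_integral lborel (\<lambda>u. indicator {a..a + 1} u *\<^sub>R (poisson_kernel r u - 1)) 0"
    by (simp add: has_bochner_integral_iff)
  have "has_bochner_integral lborel (indicator {a..a + 1}) (measure lborel {a..a + 1})"
    by (intro has_bochner_integral_real_indicator) auto
  from has_bochner_integral_add[OF * this]
  have "has_bochner_integral lborel (\<lambda>u. indicator {a..a + 1} u *\<^sub>R poisson_kernel r u) 1"
    by (simp add: algebra_simps)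
  also have "?this \<longleftrightarrow> has_bochner_integral lborel (\<lambda>u. indicator {a..<a + 1} u *\<^sub>R poisson_kernel r u) 1"
    using AE by (intro has_bochner_integral_cong_AE) (auto simp: indicator_def)
  finally show "set_integrable lborel {a..<a + 1} (poisson_kernel r)"
    and "(LBINT u:{a..<a + 1}. poisson_kernel r u) = 1"
    by (auto simp: has_bochner_integral_iff set_integrable_def set_lebesgue_integral_def)
qed

text \<open>
  As \<open>r \<rightarrow> 1\<close> the kernel concentrates on the integers like a Dirac comb.  Replacing the Gaussian by its
  value at the nearest integer leaves a factor \<open>|u - round u|\<close>, which is what makes the product
  with the kernel bounded uniformly in \<open>r\<close>, so that dominated convergence applies.
\<close>
lemma gaussian_minus_round_le:
  fixes b u :: real
  assumes "b > 0"
  shows "\<bar>exp (- b * u\<^sup>2) - exp (- b * (of_int (round u))\<^sup>2)\<bar>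
    \<le> \<bar>u - of_int (round u)\<bar> * ((1 + 2 * b) * exp (b / 8) * exp (- (b / 4) * u\<^sup>2))"
proof -
  define m where "m = real_of_int (round u)"
  have um: "\<bar>u - m\<bar> \<le> 1 / 2"
    using of_int_round_abs_le[of u] by (simp add: m_def abs_minus_commute)
  \<comment> \<open>This bounds the derivative between \<open>m\<close> and \<open>u\<close>. Half
    of the exponent \<open>b * \<xi>\<^sup>2\<close> absorbs the linear factor; the other half
    decays in \<open>u\<close>, because \<open>\<bar>u - \<xi>\<bar> \<le> 1 / 2\<close> implies
    \<open>u\<^sup>2 \<le> 2 * \<xi>\<^sup>2 + 1 / 2\<close>.\<close>
  have bd: "norm (- 2 * b * \<xi> * exp (- b * \<xi>\<^sup>2)) \<le> (1 + 2 * b) * exp (b / 8) * exp (- (b / 4) * u\<^sup>2)"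
    if "\<xi> \<in> closed_segment m u" for \<xi>
  proof -
    have "\<bar>u - \<xi>\<bar> \<le> 1 / 2"
      using segment_bound(2)[OF that] um by (simp add: abs_minus_commute)
    hence "(u - \<xi>)\<^sup>2 \<le> (1 / 2)\<^sup>2" by (metis abs_ge_zero power2_abs power_mono)
    moreover have "0 \<le> (u - 2 * \<xi>)\<^sup>2" by simp
    ultimately have u2: "u\<^sup>2 \<le> 2 * \<xi>\<^sup>2 + 1 / 2" by (simp add: power2_eq_square algebra_simps)
    have "2 * b * \<bar>\<xi>\<bar> \<le> 2 * b + b / 2 * \<bar>\<xi>\<bar>\<^sup>2"
    proof -
      have "0 \<le> b / 2 * (\<bar>\<xi>\<bar> - 2)\<^sup>2" using assms by simp
      thus ?thesis by (simp add: power2_eq_square algebra_simps)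
    qed
    also have "\<dots> \<le> (1 + 2 * b) * (1 + b / 2 * \<bar>\<xi>\<bar>\<^sup>2)"
    proof -
      define X where "X = b / 2 * \<bar>\<xi>\<bar>\<^sup>2"
      have "0 \<le> b * X" using assms by (simp add: X_def)
      thus ?thesis unfolding X_def [symmetric] by (simp add: algebra_simps)
    qed
    also have "\<dots> \<le> (1 + 2 * b) * exp (b / 2 * \<xi>\<^sup>2)"
      using exp_ge_add_one_self[of "b / 2 * \<xi>\<^sup>2"] assms by (intro mult_left_mono) auto
    finally have "2 * b * \<bar>\<xi>\<bar> * exp (- b * \<xi>\<^sup>2) \<le> (1 + 2 * b) * exp (b / 2 * \<xi>\<^sup>2) * exp (- b * \<xi>\<^sup>2)"
      by (intro mult_right_mono) auto
    also have "\<dots> = (1 + 2 * b) * exp (- (b / 2 * \<xi>\<^sup>2))"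
      by (simp flip: exp_add)
    also have "\<dots> \<le> (1 + 2 * b) * exp (b / 8 + - (b / 4) * u\<^sup>2)"
      using assms mult_left_mono[OF u2, of "b / 4"]
      by (intro mult_left_mono) (auto simp: algebra_simps)
    finally show ?thesis using assms by (simp add: abs_mult mult.assoc flip: exp_add)
  qed
  have "norm (exp (- b * u\<^sup>2) - exp (- b * m\<^sup>2)) \<le> (1 + 2 * b) * exp (b / 8) * exp (- (b / 4) * u\<^sup>2) * norm (u - m)"
  proof (rule field_differentiable_bound[where S = "closed_segment m u" and f = "\<lambda>\<xi>. exp (- b * \<xi>\<^sup>2)"])
    show "((\<lambda>\<xi>. exp (- b * \<xi>\<^sup>2)) has_field_derivative - 2 * b * \<xi> * exp (- b * \<xi>\<^sup>2)) (at \<xi> within closed_segment m u)" for \<xi>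
      by (auto intro!: derivative_eq_intros)
  qed (use bd in auto)
  thus ?thesis by (simp add: m_def mult_ac)
qed

section \<open>Poisson summation for the Gaussian\<close>

text \<open>Integrate the cosine series of the kernel term by term: each term is a value of the
  Gaussian's Fourier transform, at frequency \<open>2 pi k\<close>. The weights \<open>r ^ k\<close>
  make the exchange absolutely convergent, which it would not be at \<open>r = 1\<close>.\<close>

lemma gaussian_poisson_integral:
  assumes "b > 0" "0 \<le> r" "r < 1"
  shows "integrable lborel (\<lambda>u. exp (- b * u\<^sup>2) * poisson_kernel r u)"
    and "(LBINT u. exp (- b * u\<^sup>2) * poisson_kernel r u) =
      sqrt (pi / b) * (1 + 2 * (\<Sum>k. r ^ Suc k * exp (- (real (Suc k))\<^sup>2 * (pi\<^sup>2 / b))))"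
proof -
  define g where "g = (\<lambda>u::real. exp (- b * u\<^sup>2))"
  define f where "f = (\<lambda>k u. g u * (2 * r ^ Suc k * cos (2 * pi * real (Suc k) * u)))"
  have g_eq: "g u = exp (- (sqrt (2 * b) * u)\<^sup>2 / 2)" for u
    using assms by (simp add: g_def power_mult_distrib)
  have g_int: "integrable lborel g"
    unfolding g_eq using assms by (intro gaussian_fourier_integral(1)) simp
  have [measurable]: "g \<in> borel_measurable borel" "f k \<in> borel_measurable borel" for k
    unfolding f_def g_def by measurable
  have cos_int: "(LBINT u. cos (u * y) * g u) = sqrt (pi / b) * exp (- y\<^sup>2 / (4 * b))" for y
  proof -
    have "integrable lborel (\<lambda>t. iexp (t * y) * of_real (g t))"
      by (rule Bochner_Integration.integrable_bound[OF g_int]) (auto simp: norm_mult)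
    from integral_Re[OF this]
    have "(LBINT u. cos (u * y) * g u) = Re (CLBINT t. iexp (t * y) * of_real (g t))"
      by (simp add: Re_exp)
    also have "\<dots> = sqrt (2 * pi) / sqrt (2 * b) * exp (- (y / sqrt (2 * b))\<^sup>2 / 2)"
      unfolding g_eq using assms by (subst gaussian_fourier_integral(2)) (auto simp: Re_exp)
    also have "\<dots> = sqrt (pi / b) * exp (- y\<^sup>2 / (4 * b))"
    proof -
      have "(y / sqrt (2 * b))\<^sup>2 / 2 = y\<^sup>2 / (4 * b)"
        using assms unfolding power_divide by (subst real_sqrt_pow2) auto
      moreover have "sqrt (2 * pi) / sqrt (2 * b) = sqrt (pi / b)"
        by (simp flip: real_sqrt_divide)
      ultimately show ?thesis by simp
    qed
    finally show ?thesis .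
  qed
  have norm_le: "norm (f k u) \<le> 2 * r ^ Suc k * g u" for k u
    using assms by (auto simp: f_def g_def abs_mult mult_left_le simp del: of_nat_Suc power_Suc)
  have sm: "summable (\<lambda>k. 2 * r ^ Suc k * c)" for c
    using assms by (intro summable_mult summable_mult2 summable_geometric summable_Suc_iff[THEN iffD2]) auto
  have ptw: "(\<lambda>k. f k u) sums (g u * (poisson_kernel r u - 1))" for u
    unfolding f_def by (intro sums_mult poisson_kernel_sums assms)
  have 1: "\<And>k. integrable lborel (f k)"
    by (rule Bochner_Integration.integrable_bound[OF integrable_mult_right[OF g_int]])
       (use norm_le in \<open>auto intro!: always_eventually order_trans[OF _ abs_ge_self] simp del: power_Suc\<close>)
  have 2: "AE u in lborel. summable (\<lambda>k. norm (f k u))"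
    by (intro always_eventually allI summable_comparison_test'[OF sm]) (use norm_le in auto)
  have 3: "summable (\<lambda>k. LBINT u. norm (f k u))"
  proof (rule summable_comparison_test'[OF sm])
    fix k
    have "(LBINT u. norm (f k u)) \<le> (LBINT u. 2 * r ^ Suc k * g u)"
      using 1 norm_le g_int by (intro integral_mono integrable_norm) auto
    thus "norm (LBINT u. norm (f k u)) \<le> 2 * r ^ Suc k * integral\<^sup>L lborel g" by simp
  qed
  have i: "integrable lborel (\<lambda>u. g u * (poisson_kernel r u - 1))"
    using integrable_suminf[OF 1 2 3] by (simp only: sums_unique[OF ptw, symmetric])
  from Bochner_Integration.integrable_add[OF i g_int]
  show "integrable lborel (\<lambda>u. exp (- b * u\<^sup>2) * poisson_kernel r u)"
    by (simp add: algebra_simps g_def)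
  have fk: "integral\<^sup>L lborel (f k) = 2 * sqrt (pi / b) * (r ^ Suc k * exp (- (real (Suc k))\<^sup>2 * (pi\<^sup>2 / b)))" for k
  proof -
    have "integral\<^sup>L lborel (f k) = 2 * r ^ Suc k * (LBINT u. cos (u * (2 * pi * real (Suc k))) * g u)"
      unfolding f_def by (subst integral_mult_right_zero [symmetric]) (simp add: mult_ac)
    also have "- (2 * pi * real (Suc k))\<^sup>2 / (4 * b) = - (real (Suc k))\<^sup>2 * (pi\<^sup>2 / b)"
      using assms by (simp add: power_mult_distrib)
    hence "(LBINT u. cos (u * (2 * pi * real (Suc k))) * g u) = sqrt (pi / b) * exp (- (real (Suc k))\<^sup>2 * (pi\<^sup>2 / b))"
      unfolding cos_int by (simp only:)
    finally show ?thesis by simp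
  qed
  have "(LBINT u. g u * poisson_kernel r u) = (LBINT u. g u * (poisson_kernel r u - 1) + g u)"
    by (simp add: algebra_simps)
  also have "\<dots> = (LBINT u. g u * (poisson_kernel r u - 1)) + integral\<^sup>L lborel g"
    by (rule Bochner_Integration.integral_add[OF i g_int])
  also have "integral\<^sup>L lborel g = sqrt (pi / b)" using cos_int[of 0] by simp
  also have "(LBINT u. g u * (poisson_kernel r u - 1)) = (\<Sum>k. integral\<^sup>L lborel (f k))"
    using integral_suminf[OF 1 2 3] by (simp only: sums_unique[OF ptw, symmetric])
  also have "\<dots> = 2 * sqrt (pi / b) * (\<Sum>k. r ^ Suc k * exp (- (real (Suc k))\<^sup>2 * (pi\<^sup>2 / b)))"
    unfolding fk
  proof (rule suminf_mult, rule summable_comparison_test')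
    show "summable (\<lambda>k. exp (- (real (Suc k))\<^sup>2 * (pi\<^sup>2 / b)))"
      using theta_summable[of "pi\<^sup>2 / b" 0] assms by simp
  qed (use assms in \<open>auto simp: mult_right_le_one_le power_le_one mult_le_one simp del: of_nat_Suc power_Suc intro!: mult_left_le_one_le\<close>)
  finally show "(LBINT u. exp (- b * u\<^sup>2) * poisson_kernel r u) =
      sqrt (pi / b) * (1 + 2 * (\<Sum>k. r ^ Suc k * exp (- (real (Suc k))\<^sup>2 * (pi\<^sup>2 / b))))"
    by (simp add: g_def algebra_simps)
qed

text \<open>Halves are rounded upwards, so the fibres of \<open>round\<close> are half-open periods
  of the kernel.\<close>

lemma round_eq_iff: "round u = n \<longleftrightarrow> u \<in> {of_int n - 1 / 2..<of_int n - 1 / 2 + 1}" for u :: real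
  unfolding round_def floor_eq_iff by (auto simp: algebra_simps)

text \<open>The rounded Gaussian is constant on each fibre of \<open>round\<close>, and the kernel
  has mass 1 there; hence the value does not depend on \<open>r\<close>. The fibres over
  \<open>n\<close> and \<open>- n\<close> are paired, and the fibre over 0 is split off.\<close>

lemma gaussian_round_poisson_integral:
  assumes "b > 0" "0 \<le> r" "r < 1"
  shows "(LBINT u. exp (- b * (of_int (round u))\<^sup>2) * poisson_kernel r u) = 1 + 2 * theta_sum 0 b"
proof -
  define K where "K = (\<lambda>n u. indicator {of_int n - 1 / 2..<of_int n - 1 / 2 + 1} u * poisson_kernel r u)"
  have K_int: "integrable lborel (K n)" "integral\<^sup>L lborel (K n) = 1" for n :: int
    using poisson_kernel_period_integral[OF assms(2,3), of "of_int n - 1 / 2"]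
    by (simp_all add: K_def set_integrable_def set_lebesgue_integral_def)
  have K_nonneg: "K n u \<ge> 0" for n u
    using poisson_kernel_nonneg[OF assms(2,3)] by (simp add: K_def)
  have K_eq: "K n u = (if round u = n then poisson_kernel r u else 0)" for n u
    unfolding K_def round_eq_iff by (auto simp: indicator_def)
  define E where "E = (\<lambda>n. exp (- (real (Suc n))\<^sup>2 * b))"
  define f where "f = (\<lambda>n u. E n * (K (int (Suc n)) u + K (- int (Suc n)) u))"
  have f_int: "integrable lborel (f n)" "integral\<^sup>L lborel (f n) = 2 * E n" for n
    unfolding f_def using K_int by (simp_all add: Bochner_Integration.integral_add del: of_nat_Suc)
  have f_nonneg: "f n u \<ge> 0" for n u
    using K_nonneg by (simp add: f_def E_def)
  have E_sums: "E sums theta_sum 0 b"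
    unfolding E_def theta_sum_def using theta_summable[OF assms(1), of 0] by (simp add: summable_sums)
  have ptw: "(\<lambda>n. f n u) sums (exp (- b * (of_int (round u))\<^sup>2) * poisson_kernel r u - K 0 u)" for u
  proof (cases "round u = 0")
    case True
    thus ?thesis by (simp add: f_def K_eq del: of_nat_Suc)
  next
    case False
    define m where "m = nat \<bar>round u\<bar> - 1"
    have m: "int (Suc m) = \<bar>round u\<bar>" using False by (simp add: m_def)
    have "f n u = (if n = m then E m * poisson_kernel r u else 0)" for n
    proof -
      have "int (Suc n) = round u \<or> - int (Suc n) = round u \<longleftrightarrow> n = m"
        using m by linarith
      moreover have "\<not> (int (Suc n) = round u \<and> - int (Suc n) = round u)" by linarith
      ultimately show ?thesis unfolding f_def K_eq by (auto simp del: of_nat_Suc)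
    qed
    hence "(\<lambda>n. f n u) sums (E m * poisson_kernel r u)"
      using sums_single[of m "\<lambda>_. E m * poisson_kernel r u"] by simp
    also have "real (Suc m) = \<bar>of_int (round u)\<bar>"
      using m by (metis of_int_abs of_int_of_nat_eq)
    hence "E m = exp (- b * (of_int (round u))\<^sup>2)"
      by (simp add: E_def del: of_nat_Suc)
    finally show ?thesis using False by (simp add: K_eq)
  qed
  have "AE u in lborel. summable (\<lambda>n. norm (f n u))"
    using f_nonneg ptw by (auto simp: sums_iff)
  moreover have "summable (\<lambda>n. LBINT u. norm (f n u))"
    using f_nonneg E_sums by (simp add: f_int sums_iff)
  ultimately have
    "(\<lambda>n. integral\<^sup>L lborel (f n)) sums (LBINT u. (\<Sum>n. f n u))" "integrable lborel (\<lambda>u. \<Sum>n. f n u)"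
    using f_int sums_integral[of lborel f] integrable_suminf[of lborel f] by blast+
  hence i: "integrable lborel (\<lambda>u. exp (- b * (of_int (round u))\<^sup>2) * poisson_kernel r u - K 0 u)"
    and "(LBINT u. exp (- b * (of_int (round u))\<^sup>2) * poisson_kernel r u - K 0 u) = 2 * theta_sum 0 b"
    using sums_unique[OF ptw, symmetric] sums_mult[OF E_sums, of 2]
    by (auto simp: f_int sums_iff)
  with Bochner_Integration.integral_add[OF i K_int(1)[of 0]] show ?thesis
    by (simp add: K_int)
qed

lemma gaussian_poisson_tendsto:
  assumes "b > 0" and r: "\<And>n. 1 / 2 \<le> r n" "\<And>n. r n < 1" "r \<longlonglongrightarrow> 1"
  shows "(\<lambda>n. LBINT u. exp (- b * u\<^sup>2) * poisson_kernel (r n) u) \<longlonglongrightarrow> 1 + 2 * theta_sum 0 b"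
proof -
  define D where "D = (\<lambda>n u. (exp (- b * u\<^sup>2) - exp (- b * (of_int (round u))\<^sup>2)) * poisson_kernel (r n) u)"
  define w where "w = (\<lambda>u. (1 + 2 * b) * exp (b / 8) * exp (- (b / 4) * u\<^sup>2))"
  have w_int: "integrable lborel w"
  proof -
    have "exp (- (b / 4) * u\<^sup>2) = exp (- (sqrt (b / 2) * u)\<^sup>2 / 2)" for u
      using assms by (simp add: power_mult_distrib)
    thus ?thesis
      unfolding w_def using assms by (simp only:) (intro integrable_mult_right gaussian_fourier_integral(1), simp)
  qed
  have r0: "0 \<le> r n" for n using r(1)[of n] by simp
  have D_le: "norm (D n u) \<le> w u / 2" for n u
  proof -
    have w0: "0 \<le> w u" using assms by (simp add: w_def)
    have "norm (D n u) \<le> (\<bar>u - of_int (round u)\<bar> * w u) * poisson_kernel (r n) u"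
      unfolding D_def w_def real_norm_def abs_mult abs_of_nonneg[OF poisson_kernel_nonneg[OF r0 r(2)]]
      by (intro mult_right_mono gaussian_minus_round_le assms poisson_kernel_nonneg r0 r(2))
    also have "\<dots> = w u * (\<bar>u - of_int (round u)\<bar> * poisson_kernel (r n) u)" by simp
    also have "\<dots> \<le> w u * (1 / 2)"
      using w0 r by (intro mult_left_mono poisson_kernel_le) auto
    finally show ?thesis by simp
  qed
  have [measurable]: "(\<lambda>u::real. real_of_int (round u)) \<in> borel_measurable borel"
    unfolding round_def by measurable
  have [measurable]: "D n \<in> borel_measurable borel" for n
    unfolding D_def by measurable
  have D_int: "integrable lborel (D n)" for n
    by (rule Bochner_Integration.integrable_bound[OF integrable_divide[OF w_int, of 2]])
       (use D_le in \<open>auto intro!: always_eventually order_trans[OF _ abs_ge_self]\<close>)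
  have "(\<lambda>n. integral\<^sup>L lborel (D n)) \<longlonglongrightarrow> (LBINT u::real. (0::real))"
  proof (rule integral_dominated_convergence[where w = "\<lambda>u. w u / 2"])
    show "AE u in lborel. (\<lambda>n. D n u) \<longlonglongrightarrow> 0"
    proof (intro always_eventually allI)
      fix u :: real
      show "(\<lambda>n. D n u) \<longlonglongrightarrow> 0"
      \<comment> \<open>At an integer the kernel blows up, but there \<open>round u = u\<close> and
        the difference of Gaussians vanishes identically. Elsewhere the kernel itself tends to 0,
        its denominator staying away from 0.\<close>
      proof (cases "sin (pi * u) = 0")
        case True
        then obtain k where "u = of_int k" by (auto simp: sin_zero_iff_int2)
        thus ?thesis by (simp add: D_def)
      next
        case False
        have "(\<lambda>n. poisson_kernel (r n) u) \<longlonglongrightarrow> (1 - 1\<^sup>2) / ((1 - 1)\<^sup>2 + 4 * 1 * (sin (pi * u))\<^sup>2)"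
          unfolding poisson_kernel_def using False by (intro tendsto_intros r) auto
        from tendsto_mult_left[OF this] show ?thesis unfolding D_def by simp
      qed
    qed
  qed (use w_int D_le in auto)
  hence "(\<lambda>n. integral\<^sup>L lborel (D n)) \<longlonglongrightarrow> 0" by simp
  moreover have "(LBINT u. exp (- b * u\<^sup>2) * poisson_kernel (r n) u) = integral\<^sup>L lborel (D n) + (1 + 2 * theta_sum 0 b)" for n
  proof -
    note i = gaussian_poisson_integral(1)[OF assms(1) r0 r(2), of n]
    have "integral\<^sup>L lborel (D n) = (LBINT u. exp (- b * u\<^sup>2) * poisson_kernel (r n) u)
       - (LBINT u. exp (- b * u\<^sup>2) * poisson_kernel (r n) u - D n u)"
      using Bochner_Integration.integral_diff[OF i D_int] by simp
    also have "(\<lambda>u. exp (- b * u\<^sup>2) * poisson_kernel (r n) u - D n u) =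
        (\<lambda>u. exp (- b * (of_int (round u))\<^sup>2) * poisson_kernel (r n) u)"
      unfolding D_def by (simp add: left_diff_distrib)
    finally show ?thesis
      unfolding gaussian_round_poisson_integral[OF assms(1) r0 r(2)] by linarith
  qed
  ultimately show ?thesis
    using tendsto_add[OF _ tendsto_const[of "1 + 2 * theta_sum 0 b"]] by fastforce
qed

text \<open>The same integrals are evaluated twice as \<open>r\<close> tends to 1: through the
  cosine series, where Tannery's theorem removes the Abel weights, and through concentration on the
  integers.\<close>

lemma theta_functional_equation:
  assumes "b > 0"
  shows "1 + 2 * theta_sum 0 b = sqrt (pi / b) * (1 + 2 * theta_sum 0 (pi\<^sup>2 / b))"
proof -
  \<comment> \<open>The shift by 2 makes \<open>r 0 = 1 / 2\<close>, so the bounds required of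
    \<open>r\<close> hold from the first index.\<close>
  define r where "r = (\<lambda>n. 1 - 1 / real (n + 2))"
  have r: "1 / 2 \<le> r n" "r n < 1" for n by (simp_all add: r_def field_simps)
  have r_lim: "r \<longlonglongrightarrow> 1" unfolding r_def by real_asymp
  define E where "E = (\<lambda>k. exp (- (real (Suc k))\<^sup>2 * (pi\<^sup>2 / b)))"
  have E: "summable E" unfolding E_def using theta_summable[of "pi\<^sup>2 / b" 0] assms by simp
  have "(\<lambda>n. \<Sum>k. r n ^ Suc k * E k) \<longlonglongrightarrow> (\<Sum>k. E k)"
  proof (rule tannerys_theorem[THEN conjunct2, THEN conjunct2])
    show "(\<lambda>n. r n ^ Suc k * E k) \<longlonglongrightarrow> E k" for k
      using tendsto_mult_right[OF tendsto_power[OF r_lim, of "Suc k"], of "E k"] by simp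
    have "norm (r n ^ Suc k * E k) \<le> E k" for n k
    proof -
      have "r n ^ Suc k \<le> 1" using r[of n] by (intro power_le_one) auto
      moreover have "0 \<le> r n ^ Suc k" using r[of n] by (intro zero_le_power) auto
      ultimately show ?thesis by (simp add: E_def mult_left_le_one_le abs_mult del: power_Suc)
    qed
    thus "\<forall>\<^sub>F (k, n) in at_top \<times>\<^sub>F sequentially. norm (r n ^ Suc k * E k) \<le> E k"
      by (intro always_eventually) auto
  qed (use E in auto)
  hence "(\<lambda>n. sqrt (pi / b) * (1 + 2 * (\<Sum>k. r n ^ Suc k * E k))) \<longlonglongrightarrow> sqrt (pi / b) * (1 + 2 * (\<Sum>k. E k))"
    by (intro tendsto_intros)
  moreover have "(LBINT u. exp (- b * u\<^sup>2) * poisson_kernel (r n) u) = sqrt (pi / b) * (1 + 2 * (\<Sum>k. r n ^ Suc k * E k))" for n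
    unfolding E_def using r[of n] by (intro gaussian_poisson_integral(2)[OF assms]) auto
  ultimately have "1 + 2 * theta_sum 0 b = sqrt (pi / b) * (1 + 2 * (\<Sum>k. E k))"
    using gaussian_poisson_tendsto[OF assms r r_lim] by (simp add: LIMSEQ_unique)
  thus ?thesis by (simp add: E_def theta_sum_def)
qed

section \<open>The distribution of the random variable\<close>

text \<open>Expand zeta and invert each term at \<open>Y n = pi n^2 x^2\<close>. On the line the
  terms are bounded by a multiple of \<open>n powr (- c)\<close> times the modulus of the Gamma
  factor, so \<open>c > 1\<close> permits the exchange of sum and integral. The result is free of
  \<open>c\<close>.\<close>

lemma w1_eq_theta_sum:
  assumes "c > 1" "x > 0"
  shows "w1 c x = of_real (2 * theta_sum 0 (pi * x\<^sup>2))"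
proof -
  define Y where "Y = (\<lambda>n. (real (Suc n))\<^sup>2 * (pi * x\<^sup>2))"
  define h where "h = (\<lambda>n t. Gamma (Complex (c/2) t) * of_real (Y n) powr (- Complex (c/2) t))"
  have Y: "Y n > 0" for n using assms by (simp add: Y_def)
  have h_norm: "norm (h n t) = Y n powr (- (c/2)) * norm (Gamma (Complex (c/2) t))" for n t
    using Y[of n] by (simp add: h_def norm_mult norm_powr_real_powr mult.commute)
  have Gamma_int: "integrable lborel (\<lambda>t. Gamma (Complex (c/2) t))"
    using assms by (intro integrable_Gamma_vertical) simp
  have [measurable]: "(\<lambda>t. Gamma (Complex (c/2) t)) \<in> borel_measurable borel"
    using Gamma_int by auto
  have [measurable]: "h n \<in> borel_measurable borel" for n
  proof -
    have "continuous_on UNIV (\<lambda>t. of_real (Y n) powr (- Complex (c/2) t))"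
      unfolding powr_def Complex_eq using Y[of n] by (auto intro!: continuous_intros)
    hence [measurable]: "(\<lambda>t. of_real (Y n) powr (- Complex (c/2) t)) \<in> borel_measurable borel"
      by (rule borel_measurable_continuous_onI)
    show ?thesis unfolding h_def by measurable
  qed
  have h_int: "integrable lborel (h n)" for n
    by (rule Bochner_Integration.integrable_bound[OF integrable_mult_right[OF Gamma_int, of "of_real (Y n powr (- (c/2)))"]])
       (auto simp: h_norm norm_mult)
  have Y_powr: "Y n powr (- (c/2)) = (pi * x\<^sup>2) powr (- (c/2)) * real (Suc n) powr (- c)" for n
    using assms by (simp add: Y_def powr_mult powr_powr flip: powr_numeral)
  have sm_c: "summable (\<lambda>n. real (Suc n) powr (- c))"
    using assms by (subst summable_Suc_iff) (simp add: summable_real_powr_iff)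
  have sm: "summable (\<lambda>n. Y n powr (- (c/2)))"
    unfolding Y_powr by (rule summable_mult[OF sm_c])
  have integrand: "Gamma (s / 2) * zeta s * of_real pi powr (- s / 2) * of_real x powr (- s) = (\<Sum>n. h n (t/2))"
    if "s = Complex c t" for s t
  proof -
    have s2: "Complex (c/2) (t/2) = s / 2" using that by (simp add: complex_eq_iff)
    have 1: "h n (t/2) = (Gamma (s / 2) * of_real pi powr (- s / 2) * of_real x powr (- s)) * of_nat (Suc n) powr (- s)" for n
    proof -
      have "complex_of_real (ln (Y n)) = of_real (2 * ln (real (Suc n)) + ln pi + 2 * ln x)"
        using assms by (simp add: Y_def ln_mult ln_realpow)
      hence "- (s / 2) * complex_of_real (ln (Y n)) = - s * ln (real (Suc n)) - s / 2 * ln pi - s * ln x"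
        by (simp only:) (simp add: algebra_simps)
      hence "complex_of_real (Y n) powr (- (s / 2)) = exp (- s * ln (real (Suc n)) - s / 2 * ln pi - s * ln x)"
        using Y[of n] by (simp add: powr_def Ln_of_real)
      also have "\<dots> = of_nat (Suc n) powr (- s) * of_real pi powr (- s / 2) * of_real x powr (- s)"
        using assms Ln_of_nat[of "Suc n"]
        by (simp add: powr_def Ln_of_real exp_diff exp_minus field_simps del: of_nat_Suc flip: exp_add)
      finally show ?thesis unfolding h_def s2 by (simp add: mult_ac)
    qed
    have "summable (\<lambda>n. norm (of_nat (Suc n) powr (- s)))"
      using sm_c that by (simp add: norm_powr_real_powr)
    hence "summable (\<lambda>n. of_nat (Suc n) powr (- s))" by (rule summable_norm_cancel)
    thus ?thesis unfolding 1 zeta_def by (subst suminf_mult) (auto simp: mult_ac)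
  qed
  \<comment> \<open>Gamma is taken at \<open>s / 2\<close>, whose imaginary part is
    \<open>t / 2\<close>; rescaling produces the factor 2 in front of the theta series.\<close>
  have "(CLBINT t. (\<Sum>n. h n (t/2))) = 2 *\<^sub>R (CLBINT t. (\<Sum>n. h n t))"
    using lborel_integral_real_affine[of 2 "\<lambda>t. (\<Sum>n. h n (t/2))" 0] by simp
  also have "(CLBINT t. (\<Sum>n. h n t)) = (\<Sum>n. (CLBINT t. h n t))"
  proof (rule integral_suminf)
    show "AE t in lborel. summable (\<lambda>n. norm (h n t))"
      unfolding h_norm using sm by (intro always_eventually allI summable_mult2)
    show "summable (\<lambda>n. LBINT t. norm (h n t))"
      unfolding h_norm using sm by (simp add: summable_mult2)
  qed (rule h_int)
  also have "(\<lambda>n. CLBINT t. h n t) = (\<lambda>n. of_real (2 * pi * exp (- Y n)))"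
    unfolding h_def using assms Y by (intro ext inverse_mellin_Gamma) auto
  also have "(\<Sum>n. complex_of_real (2 * pi * exp (- Y n))) = of_real (2 * pi * theta_sum 0 (pi * x\<^sup>2))"
  proof -
    have "(\<lambda>n. exp (- Y n)) sums theta_sum 0 (pi * x\<^sup>2)"
      using theta_summable[of "pi * x\<^sup>2" 0] assms by (simp add: Y_def theta_sum_def summable_sums)
    from sums_of_real[OF sums_mult[OF this, of "2 * pi"]] show ?thesis by (rule sums_unique [symmetric])
  qed
  finally show ?thesis
    unfolding w1_def vertical_line_integral_def integrand[OF refl] 
    by (simp add: scaleR_conv_of_real)
qed

section \<open>Closed forms of the distribution function and the density\<close>

lemma theta_sum_mono:
  assumes "u > 0"
  shows "theta_sum k u \<le> theta_sum (Suc k) u"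
  unfolding theta_sum_def
  by (intro suminf_le theta_summable assms mult_right_mono power_increasing) auto

text \<open>The function F of the overview, in the form that comes from differentiating
  \<open>y \<theta>(y)\<close>. Its role as distribution function is established only for positive
  arguments.\<close>

definition X1_cdf :: "real \<Rightarrow> real" where
  "X1_cdf y = 1 + 2 * theta_sum 0 (pi * y\<^sup>2) - 4 * pi * y\<^sup>2 * theta_sum 1 (pi * y\<^sup>2)"

definition X1_pdf :: "real \<Rightarrow> real" where
  "X1_pdf y = 8 * pi\<^sup>2 * y ^ 3 * theta_sum 2 (pi * y\<^sup>2) - 12 * pi * y * theta_sum 1 (pi * y\<^sup>2)"

lemma theta_sum_chain [derivative_intros]:
  assumes "(g has_field_derivative g') (at y within A)" "g y > 0"
  shows "((\<lambda>y. theta_sum k (g y)) has_field_derivative - theta_sum (Suc k) (g y) * g') (at y within A)"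
  using DERIV_chain2[OF theta_sum_has_derivative[OF assms(2)] assms(1)] .

lemma X1_cdf_has_derivative:
  assumes "y > 0"
  shows "(X1_cdf has_field_derivative X1_pdf y) (at y)"
  unfolding X1_cdf_def [abs_def] X1_pdf_def
  using assms by (auto intro!: derivative_eq_intros simp: eval_nat_numeral algebra_simps)

text \<open>
  Differentiate \<open>v \<theta>(v) = \<theta>(1/v)\<close> at \<open>y\<close>.
\<close>
lemma X1_cdf_eq:
  assumes "y > 0"
  shows "X1_cdf y = 4 * pi / y ^ 3 * theta_sum 1 (pi / y\<^sup>2)"
proof (rule DERIV_unique)
  have eq: "v * (1 + 2 * theta_sum 0 (pi * v\<^sup>2)) = 1 + 2 * theta_sum 0 (pi / v\<^sup>2)" if "v > 0" for v
  proof -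
    have "1 + 2 * theta_sum 0 (pi * v\<^sup>2) = sqrt (pi / (pi * v\<^sup>2)) * (1 + 2 * theta_sum 0 (pi\<^sup>2 / (pi * v\<^sup>2)))"
      using that by (intro theta_functional_equation) simp
    also have "sqrt (pi / (pi * v\<^sup>2)) = 1 / v"
      using that by (simp add: real_sqrt_divide)
    also have "pi\<^sup>2 / (pi * v\<^sup>2) = pi / v\<^sup>2" by (simp add: power2_eq_square)
    finally show ?thesis using that by (simp add: field_simps)
  qed
  show "((\<lambda>v. v * (1 + 2 * theta_sum 0 (pi * v\<^sup>2))) has_field_derivative X1_cdf y) (at y)"
    unfolding X1_cdf_def
    using assms by (auto intro!: derivative_eq_intros simp: power2_eq_square algebra_simps)
  have "((\<lambda>v. 1 + 2 * theta_sum 0 (pi / v\<^sup>2)) has_field_derivative 4 * pi / y ^ 3 * theta_sum 1 (pi / y\<^sup>2)) (at y)"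
    using assms
    by (auto intro!: derivative_eq_intros simp: power2_eq_square power3_eq_cube field_simps)
  thus "((\<lambda>v. v * (1 + 2 * theta_sum 0 (pi * v\<^sup>2))) has_field_derivative 4 * pi / y ^ 3 * theta_sum 1 (pi / y\<^sup>2)) (at y)"
    by (rule has_field_derivative_transform_within_open[where S = "{0<..}"]) (use assms eq in auto)
qed

text \<open>Both forms of F have a derivative that is a positive factor times
  \<open>2 pi s theta_sum 2 u - 3 t theta_sum 1 u\<close>, and this is nonnegative when
  \<open>t \<le> s\<close>, as \<open>theta_sum 1 \<le> theta_sum 2\<close>. The first form has
  \<open>s = y^2\<close>, \<open>t = 1\<close> and settles \<open>y \<ge> 1\<close>; the transformed
  one has \<open>s = 1\<close>, \<open>t = y^2\<close> and settles \<open>y < 1\<close>.\<close>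

lemma X1_pdf_nonneg:
  assumes "y > 0"
  shows "X1_pdf y \<ge> 0"
proof -
  have *: "3 * t * theta_sum 1 u \<le> 2 * pi * s * theta_sum 2 u" if "u > 0" "0 \<le> t" "t \<le> s" for u s t
    using that pi_gt3 theta_sum_mono[of u 1] theta_sum_pos[of u 1]
    by (intro mult_mono) (auto simp: numeral_2_eq_2)
  show ?thesis
  proof (cases "y \<ge> 1")
    case True
    have "3 * 1 * theta_sum 1 (pi * y\<^sup>2) \<le> 2 * pi * y\<^sup>2 * theta_sum 2 (pi * y\<^sup>2)"
      using True by (intro *) auto
    hence "(4 * pi * y) * (3 * 1 * theta_sum 1 (pi * y\<^sup>2)) \<le> (4 * pi * y) * (2 * pi * y\<^sup>2 * theta_sum 2 (pi * y\<^sup>2))"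
      using assms by (intro mult_left_mono) auto
    thus ?thesis by (simp add: X1_pdf_def power2_eq_square power3_eq_cube mult_ac)
  next
    case False
    define D where "D = 4 * pi / y ^ 6 * (2 * pi * 1 * theta_sum 2 (pi / y\<^sup>2) - 3 * y\<^sup>2 * theta_sum 1 (pi / y\<^sup>2))"
    have "((\<lambda>v. 4 * pi / v ^ 3 * theta_sum 1 (pi / v\<^sup>2)) has_field_derivative D) (at y)"
      unfolding D_def using assms
      by (auto intro!: derivative_eq_intros simp: field_simps eval_nat_numeral)
    moreover have "((\<lambda>v. 4 * pi / v ^ 3 * theta_sum 1 (pi / v\<^sup>2)) has_field_derivative X1_pdf y) (at y)"
      by (rule has_field_derivative_transform_within_open[where S = "{0<..}", OF X1_cdf_has_derivative])
         (use assms X1_cdf_eq in auto)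
    ultimately have "X1_pdf y = D" by (rule DERIV_unique[rotated])
    moreover have "3 * y\<^sup>2 * theta_sum 1 (pi / y\<^sup>2) \<le> 2 * pi * 1 * theta_sum 2 (pi / y\<^sup>2)"
      using assms False by (intro *) (auto simp: power_le_one)
    hence "D \<ge> 0" unfolding D_def using assms by simp
    ultimately show ?thesis by simp
  qed
qed

lemma X1_cdf_tendsto_1: "(X1_cdf \<longlongrightarrow> 1) at_top"
proof -
  have lim: "filterlim (\<lambda>y::real. pi * y\<^sup>2) at_top at_top" by real_asymp
  have "((\<lambda>y. 1 + 2 * ((pi * y\<^sup>2) ^ 0 * theta_sum 0 (pi * y\<^sup>2)) - 4 * ((pi * y\<^sup>2) ^ 1 * theta_sum 1 (pi * y\<^sup>2)))
      \<longlongrightarrow> 1 + 2 * 0 - 4 * 0) at_top"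
    by (intro tendsto_intros filterlim_compose[OF theta_sum_tendsto_0 lim])
  thus ?thesis by (simp add: X1_cdf_def [abs_def] mult.assoc)
qed

text \<open>The identity behind this is \<open>(x^2 \<theta>')' = x (x \<theta>)''\<close>. The
  formulas for \<open>w1\<close> hold on the open half-line, which is enough to differentiate
  there.\<close>

lemma v1_eq:
  assumes "c > 1" "x > 0"
  shows "v1 c x = of_real (x * X1_pdf x)"
proof -
  have w: "vector_derivative (w1 c) (at y) = of_real (- 4 * pi * y * theta_sum 1 (pi * y\<^sup>2))" if "y > 0" for y
  proof (rule vector_derivative_at)
    have "((\<lambda>y. 2 * theta_sum 0 (pi * y\<^sup>2)) has_field_derivative - 4 * pi * y * theta_sum 1 (pi * y\<^sup>2)) (at y)"
      using that by (auto intro!: derivative_eq_intros)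
    hence "((\<lambda>y. complex_of_real (2 * theta_sum 0 (pi * y\<^sup>2))) has_vector_derivative of_real (- 4 * pi * y * theta_sum 1 (pi * y\<^sup>2))) (at y)"
      by (rule has_vector_derivative_of_real)
    thus "(w1 c has_vector_derivative of_real (- 4 * pi * y * theta_sum 1 (pi * y\<^sup>2))) (at y)"
      by (rule has_vector_derivative_transform_within_open[where S = "{0<..}"])
         (use that assms w1_eq_theta_sum in auto)
  qed
  show ?thesis
    unfolding v1_def
  proof (rule vector_derivative_at)
    have "((\<lambda>y. - 4 * pi * y ^ 3 * theta_sum 1 (pi * y\<^sup>2)) has_field_derivative x * X1_pdf x) (at x)"
      unfolding X1_pdf_def using assms
      by (auto intro!: derivative_eq_intros simp: eval_nat_numeral algebra_simps)
    hence "((\<lambda>y. complex_of_real (- 4 * pi * y ^ 3 * theta_sum 1 (pi * y\<^sup>2))) has_vector_derivative of_real (x * X1_pdf x)) (at x)"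
      by (rule has_vector_derivative_of_real)
    thus "((\<lambda>y. of_real (y\<^sup>2) * vector_derivative (w1 c) (at y)) has_vector_derivative of_real (x * X1_pdf x)) (at x)"
      by (rule has_vector_derivative_transform_within_open[where S = "{0<..}"])
         (use assms in \<open>auto simp: w power2_eq_square power3_eq_cube\<close>)
  qed
qed

text \<open>The tail beyond \<open>y\<close> is the integral of the derivative of F up to infinity,
  where F tends to 1; the complement gives the claim.\<close>

lemma prob_X1_le:
  assumes "prob_space M" "c > 1" "distributed M lborel X1 (X1_density c)" "y > 0"
  shows "\<P>(\<omega> in M. X1 \<omega> \<le> y) = X1_cdf y"
proof -
  interpret prob_space M by fact
  \<comment> \<open>This version of the density is real, nonnegative and Borel measurable
    everywhere, while \<open>X1_pdf\<close> is controlled only on positive arguments.\<close>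
  define f where "f = (\<lambda>x. enn2real (X1_density c x))"
  have X1_density_eq: "X1_density c x = ennreal (X1_pdf x)" if "x > 0" for x
    using assms that by (simp add: X1_density_def v1_eq)
  have [measurable]: "X1_density c \<in> borel_measurable borel" "X1 \<in> borel_measurable M"
    using distributed_borel_measurable[OF assms(3)] distributed_measurable[OF assms(3)] by auto
  have f_eq: "f x = X1_pdf x" if "x > 0" for x
    using that X1_pdf_nonneg by (simp add: f_def X1_density_eq)
  have "emeasure M (X1 -` {y<..} \<inter> space M) = (\<integral>\<^sup>+x. X1_density c x * indicator {y<..} x \<partial>lborel)"
    by (rule distributed_emeasure[OF assms(3)]) simp
  also have "\<dots> = (\<integral>\<^sup>+x. ennreal (f x) * indicator {y..} x \<partial>lborel)"
    using AE_lborel_singleton[of y] assms(4)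
    by (intro nn_integral_cong_AE) (auto elim!: eventually_mono simp: indicator_def X1_density_eq f_eq)
  also have "\<dots> = 1 - X1_cdf y"
  proof (rule nn_integral_FTC_atLeast)
    show "DERIV X1_cdf x :> f x" if "y \<le> x" for x
      using that assms(4) X1_cdf_has_derivative[of x] by (simp add: f_eq)
  qed (auto simp: f_def X1_cdf_tendsto_1)
  finally have "emeasure M (X1 -` {y<..} \<inter> space M) = ennreal (1 - X1_cdf y)" .
  \<comment> \<open>Since \<open>ennreal\<close> sends negative numbers to 0, the sign is needed to
    read off a real probability. F increases to its limit 1.\<close>
  moreover have "1 - X1_cdf y \<ge> 0"
  proof (rule tendsto_lowerbound)
    show "((\<lambda>z. X1_cdf z - X1_cdf y) \<longlongrightarrow> 1 - X1_cdf y) at_top"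
      by (intro tendsto_intros X1_cdf_tendsto_1)
    show "\<forall>\<^sub>F z in at_top. 0 \<le> X1_cdf z - X1_cdf y"
      using eventually_ge_at_top[of y]
    proof eventually_elim
      case (elim z)
      have "X1_cdf y \<le> X1_cdf z"
        using assms(4) by (intro DERIV_nonneg_imp_nondecreasing[OF elim])
          (meson X1_cdf_has_derivative X1_pdf_nonneg less_le_trans)
      thus ?case by simp
    qed
  qed simp
  ultimately have "prob {\<omega> \<in> space M. y < X1 \<omega>} = 1 - X1_cdf y"
    by (simp add: measure_def vimage_def Int_def conj_commute)
  moreover have "prob {\<omega> \<in> space M. \<not> (y < X1 \<omega>)} = 1 - prob {\<omega> \<in> space M. y < X1 \<omega>}"
    by (rule prob_neg) measurable
  ultimately show ?thesis by (simp add: not_less)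
qed

section \<open>The Bessel function and the divisor sum\<close>

text \<open>The crude cubic bound is enough for what follows: it makes \<open>k\<close> times the
  Bessel value at a multiple of \<open>k\<close> of order \<open>1 / k^2\<close>.\<close>

lemma bessel_K_1_nn_integral:
  assumes "z > 0"
  shows "(\<integral>\<^sup>+t\<in>{0<..}. ennreal (exp (- z * cosh t) * cosh t) \<partial>lborel) = ennreal (bessel_K 1 z)"
    and "0 \<le> bessel_K 1 z" and "bessel_K 1 z \<le> (3 / z) ^ 3"
proof -
  define h where "h = (\<lambda>t. exp (- z * cosh t) * cosh t)"
  have [measurable]: "h \<in> borel_measurable borel"
    unfolding h_def by (intro borel_measurable_continuous_onI continuous_intros)
  have [measurable]: "(tanh :: real \<Rightarrow> real) \<in> borel_measurable borel"
    by (intro borel_measurable_continuous_onI continuous_intros) auto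
  have h0: "h t \<ge> 0" for t by (simp add: h_def)
  \<comment> \<open>The third power outweighs the factor \<open>cosh t\<close> and leaves
    \<open>1 / (cosh t)\<^sup>2\<close>, the derivative of \<open>tanh\<close>.\<close>
  have h_le: "h t \<le> (3 / z) ^ 3 * (1 - (tanh t)\<^sup>2)" for t
  proof -
    have "h t \<le> (real 3 / (z * cosh t)) ^ 3 * cosh t"
      using exp_minus_le_power[of "z * cosh t" 3] assms unfolding h_def
      by (intro mult_right_mono) auto
    also have "\<dots> = (3 / z) ^ 3 * (1 / (cosh t)\<^sup>2)"
      using cosh_real_pos[of t] by (simp add: power_divide power_mult_distrib eval_nat_numeral)
    also have "1 / (cosh t)\<^sup>2 = ((cosh t)\<^sup>2 - (sinh t)\<^sup>2) / (cosh t)\<^sup>2"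
      by (simp add: cosh_square_eq)
    also have "\<dots> = 1 - (tanh t)\<^sup>2"
      by (simp add: diff_divide_distrib tanh_def power_divide)
    finally show ?thesis .
  qed
  have "(\<integral>\<^sup>+t\<in>{0<..}. ennreal (h t) \<partial>lborel) \<le> (\<integral>\<^sup>+t\<in>{0..}. ennreal ((3 / z) ^ 3 * (1 - (tanh t)\<^sup>2)) \<partial>lborel)"
    using h_le by (intro nn_integral_mono) (auto simp: indicator_def ennreal_leI)
  also have "\<dots> = ennreal ((3 / z) ^ 3 * 1 - (3 / z) ^ 3 * tanh 0)"
  proof (rule nn_integral_FTC_atLeast)
    show "((\<lambda>t. (3 / z) ^ 3 * tanh t) has_real_derivative (3 / z) ^ 3 * (1 - (tanh t)\<^sup>2)) (at t)" for t
      by (auto intro!: derivative_eq_intros)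
    show "((\<lambda>t. (3 / z) ^ 3 * tanh t) \<longlongrightarrow> (3 / z) ^ 3 * 1) at_top"
      by (intro tendsto_intros tanh_real_at_top)
    show "0 \<le> (3 / z) ^ 3 * (1 - (tanh t)\<^sup>2)" for t
      using h0[of t] h_le[of t] by linarith
  qed auto
  finally have le: "(\<integral>\<^sup>+t\<in>{0<..}. ennreal (h t) \<partial>lborel) \<le> ennreal ((3 / z) ^ 3)" by simp
  define g where "g = (\<lambda>t. indicator {0<..} t *\<^sub>R h t)"
  have [measurable]: "g \<in> borel_measurable borel" unfolding g_def by measurable
  have g0: "g t \<ge> 0" for t using h0 by (simp add: g_def)
  have eq: "(\<integral>\<^sup>+t\<in>{0<..}. ennreal (h t) \<partial>lborel) = (\<integral>\<^sup>+t. ennreal (g t) \<partial>lborel)"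
    by (intro nn_integral_cong) (auto simp: g_def indicator_def)
  have "integrable lborel g"
    using le g0 unfolding eq by (intro integrableI_nonneg) (auto intro: le_less_trans)
  hence "(\<integral>\<^sup>+t. ennreal (g t) \<partial>lborel) = ennreal (integral\<^sup>L lborel g)"
    using g0 by (intro nn_integral_eq_integral) auto
  moreover have K: "integral\<^sup>L lborel g = bessel_K 1 z"
    by (simp add: g_def h_def bessel_K_def set_lebesgue_integral_def)
  ultimately show *: "(\<integral>\<^sup>+t\<in>{0<..}. ennreal (exp (- z * cosh t) * cosh t) \<partial>lborel) = ennreal (bessel_K 1 z)"
    using eq by (simp add: h_def)
  show "0 \<le> bessel_K 1 z" unfolding K [symmetric] using g0 by simp
  show "bessel_K 1 z \<le> (3 / z) ^ 3"
    using le * assms by (simp add: h_def)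
qed

lemma nn_integral_lborel_fold:
  fixes h :: "real \<Rightarrow> ennreal"
  assumes [measurable]: "h \<in> borel_measurable borel"
  shows "(\<integral>\<^sup>+t. h t \<partial>lborel) = (\<integral>\<^sup>+t\<in>{0<..}. h t + h (- t) \<partial>lborel)"
proof -
  have "(\<integral>\<^sup>+t. h t \<partial>lborel) = (\<integral>\<^sup>+t. h t * indicator {0<..} t + h t * indicator {..<0} t \<partial>lborel)"
    using AE_lborel_singleton[of "0::real"]
    by (intro nn_integral_cong_AE) (auto elim!: eventually_mono simp: indicator_def)
  also have "\<dots> = (\<integral>\<^sup>+t\<in>{0<..}. h t \<partial>lborel) + (\<integral>\<^sup>+t\<in>{..<0}. h t \<partial>lborel)"
    by (intro nn_integral_add) auto
  also have "(\<integral>\<^sup>+t\<in>{..<0}. h t \<partial>lborel) = (\<integral>\<^sup>+t\<in>{0<..}. h (- t) \<partial>lborel)"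
    by (subst nn_integral_real_affine[where c = "-1" and t = 0])
       (auto intro!: nn_integral_cong simp: indicator_def)
  also have "(\<integral>\<^sup>+t\<in>{0<..}. h t \<partial>lborel) + (\<integral>\<^sup>+t\<in>{0<..}. h (- t) \<partial>lborel) = (\<integral>\<^sup>+t\<in>{0<..}. h t + h (- t) \<partial>lborel)"
    by (subst nn_integral_add [symmetric]) (auto simp: distrib_right)
  finally show ?thesis .
qed

text \<open>The substitution \<open>y = (A / B)^(1/4) exp (- t / 2)\<close> balances the exponents:
  \<open>A / y^2\<close> and \<open>B y^2\<close> become \<open>sqrt (A B)\<close> times
  \<open>exp t\<close> and \<open>exp (- t)\<close>, so their sum is \<open>z cosh t\<close>. The
  constant \<open>\<alpha>\<close> is the logarithm of that fourth root.\<close>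

lemma bessel_K_1_gaussian_integral:
  fixes A B :: real
  assumes "A > 0" "B > 0"
  shows "(\<integral>\<^sup>+y\<in>{0<..}. ennreal (exp (- (A / y\<^sup>2) - B * y\<^sup>2) / y ^ 3) \<partial>lborel) =
    ennreal (sqrt (B / A) * bessel_K 1 (2 * sqrt (A * B)))"
proof -
  define z where "z = 2 * sqrt (A * B)"
  have [measurable]: "(cosh :: real \<Rightarrow> real) \<in> borel_measurable borel"
    by (intro borel_measurable_continuous_onI continuous_intros)
  define \<alpha> where "\<alpha> = ln (A / B) / 4"
  have z: "z > 0" using assms by (simp add: z_def)
  have exp_\<alpha>: "exp (2 * \<alpha>) = sqrt (A / B)"
  proof -
    have "exp (2 * \<alpha>) = exp (ln (sqrt (A / B)))"
      using assms by (simp add: \<alpha>_def ln_sqrt)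
    thus ?thesis using assms by simp
  qed
  have sq: "sqrt A * sqrt A = A" "sqrt B * sqrt B = B" using assms by auto
  have pointwise: "ennreal (exp (- (A / (exp (\<alpha> + - (1/2) * t))\<^sup>2) - B * (exp (\<alpha> + - (1/2) * t))\<^sup>2)
        / exp (\<alpha> + - (1/2) * t) ^ 3) * ennreal (exp (\<alpha> + - (1/2) * t)) =
        ennreal (sqrt (B / A)) * ennreal (exp (- z * cosh t) * exp t)" for t
  proof -
    define e where "e = exp (\<alpha> + - (1/2) * t)"
    have "e\<^sup>2 = exp (2 * \<alpha> + - t)" by (simp add: e_def power2_eq_square flip: exp_add)
    also have "\<dots> = sqrt (A / B) * exp (- t)" by (simp only: exp_add exp_\<alpha>)
    finally have e2: "e\<^sup>2 = sqrt (A / B) * exp (- t)" .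
    have "e > 0" by (simp add: e_def)
    have 1: "B * e\<^sup>2 = sqrt (A * B) * exp (- t)"
      using assms sq by (simp add: e2 real_sqrt_divide real_sqrt_mult field_simps)
    have inv: "1 / e\<^sup>2 = sqrt (B / A) * exp t"
      using assms by (simp add: e2 real_sqrt_divide exp_minus field_simps)
    have "A / e\<^sup>2 = A * (1 / e\<^sup>2)" by simp
    also have "\<dots> = sqrt (A * B) * exp t"
      unfolding inv using assms sq by (simp add: real_sqrt_divide real_sqrt_mult field_simps)
    finally have 2: "- (A / e\<^sup>2) - B * e\<^sup>2 = - z * cosh t"
      using 1 by (simp add: z_def cosh_def field_simps)
    have "exp (- (A / e\<^sup>2) - B * e\<^sup>2) / e ^ 3 * e = exp (- (A / e\<^sup>2) - B * e\<^sup>2) * (1 / e\<^sup>2)"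
      using \<open>e > 0\<close> by (simp add: power2_eq_square power3_eq_cube)
    also have "\<dots> = sqrt (B / A) * (exp (- z * cosh t) * exp t)"
      unfolding inv 2 by simp
    finally show ?thesis
      unfolding e_def [symmetric] using assms \<open>e > 0\<close> by (simp flip: ennreal_mult)
  qed
  have "(\<integral>\<^sup>+y\<in>{0<..}. ennreal (exp (- (A / y\<^sup>2) - B * y\<^sup>2) / y ^ 3) \<partial>lborel) =
      (\<integral>\<^sup>+s. ennreal (exp (- (A / (exp s)\<^sup>2) - B * (exp s)\<^sup>2) / exp s ^ 3) * ennreal (exp s) \<partial>lborel)"
    by (rule nn_integral_exp_substitution) measurable
  also have "\<dots> = ennreal \<bar>- (1/2)\<bar> * (\<integral>\<^sup>+t. ennreal (exp (- (A / (exp (\<alpha> + - (1/2) * t))\<^sup>2) - B * (exp (\<alpha> + - (1/2) * t))\<^sup>2)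
        / exp (\<alpha> + - (1/2) * t) ^ 3) * ennreal (exp (\<alpha> + - (1/2) * t)) \<partial>lborel)"
    by (rule nn_integral_real_affine) auto
  also have "\<dots> = ennreal (1 / 2) * (\<integral>\<^sup>+t. ennreal (sqrt (B / A)) * ennreal (exp (- z * cosh t) * exp t) \<partial>lborel)"
    unfolding pointwise by simp
  also have "\<dots> = ennreal (1 / 2 * sqrt (B / A)) * (\<integral>\<^sup>+t. ennreal (exp (- z * cosh t) * exp t) \<partial>lborel)"
  proof -
    have "(\<integral>\<^sup>+t. ennreal (sqrt (B / A)) * ennreal (exp (- z * cosh t) * exp t) \<partial>lborel) =
        ennreal (sqrt (B / A)) * (\<integral>\<^sup>+t. ennreal (exp (- z * cosh t) * exp t) \<partial>lborel)"
      by (rule nn_integral_cmult) measurable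
    moreover have "ennreal (1 / 2 * sqrt (B / A)) = ennreal (1 / 2) * ennreal (sqrt (B / A))"
      using assms by (intro ennreal_mult) auto
    ultimately show ?thesis by (simp only: mult.assoc)
  qed
  \<comment> \<open>Folding at 0 replaces \<open>exp t\<close> by
    \<open>exp t + exp (- t) = 2 * cosh t\<close>, the integrand of the Bessel function of order 1;
    this 2 cancels the Jacobian \<open>1 / 2\<close>.\<close>
  also have "(\<integral>\<^sup>+t. ennreal (exp (- z * cosh t) * exp t) \<partial>lborel) =
      (\<integral>\<^sup>+t\<in>{0<..}. ennreal (exp (- z * cosh t) * exp t) + ennreal (exp (- z * cosh (- t)) * exp (- t)) \<partial>lborel)"
    by (rule nn_integral_lborel_fold) measurable
  also have "\<dots> = (\<integral>\<^sup>+t. ennreal 2 * (ennreal (exp (- z * cosh t) * cosh t) * indicator {0<..} t) \<partial>lborel)"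
  proof (intro nn_integral_cong)
    fix t :: real
    have "exp t + exp (- t) = 2 * cosh t" by (simp add: cosh_def)
    hence "exp (- z * cosh t) * exp t + exp (- z * cosh (- t)) * exp (- t) = 2 * (exp (- z * cosh t) * cosh t)"
      by (simp flip: distrib_left)
    hence "ennreal (exp (- z * cosh t) * exp t) + ennreal (exp (- z * cosh (- t)) * exp (- t)) =
        ennreal 2 * ennreal (exp (- z * cosh t) * cosh t)"
      by (subst ennreal_plus [symmetric], simp, simp, subst ennreal_mult [symmetric]) auto
    thus "(ennreal (exp (- z * cosh t) * exp t) + ennreal (exp (- z * cosh (- t)) * exp (- t))) * indicator {0<..} t =
        ennreal 2 * (ennreal (exp (- z * cosh t) * cosh t) * indicator {0<..} t)"
      by (simp only: mult.assoc)
  qed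
  also have "\<dots> = ennreal 2 * ennreal (bessel_K 1 z)"
    unfolding bessel_K_1_nn_integral(1)[OF z, symmetric] by (rule nn_integral_cmult) measurable
  also have "ennreal (1 / 2 * sqrt (B / A)) * (ennreal 2 * ennreal (bessel_K 1 z)) =
      ennreal (1 / 2 * sqrt (B / A) * (2 * bessel_K 1 z))"
    using assms bessel_K_1_nn_integral(2)[OF z]
    by (subst ennreal_mult [symmetric], simp, simp, subst ennreal_mult [symmetric]) auto
  finally show ?thesis by (simp add: z_def)
qed

section \<open>Rearrangement of nonnegative double series\<close>

lemma has_sum_atLeast_1:
  fixes f :: "nat \<Rightarrow> real"
  assumes "(\<lambda>n. f (Suc n)) sums S" "\<And>n. f n \<ge> 0"
  shows "(f has_sum S) {1..}"
proof -
  have "((f \<circ> Suc) has_sum S) UNIV"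
    using assms by (intro sums_nonneg_imp_has_sum) (auto simp: o_def)
  hence "(f has_sum S) (range Suc)"
    by (subst has_sum_reindex) auto
  also have "range Suc = {1..}" by (auto simp: image_iff Suc_le_eq gr0_conv_Suc)
  finally show ?thesis .
qed

lemma suminf_ennreal_atLeast_1:
  fixes f :: "nat \<Rightarrow> real"
  assumes "(f has_sum S) {1..}" "\<And>n. f n \<ge> 0"
  shows "(\<Sum>n. ennreal (f (Suc n))) = ennreal S"
proof (rule suminf_ennreal_eq)
  have "range Suc = {1..}" by (auto simp: image_iff Suc_le_eq gr0_conv_Suc)
  hence "((f \<circ> Suc) has_sum S) UNIV"
    using assms(1) by (subst has_sum_reindex [symmetric]) auto
  thus "(\<lambda>n. f (Suc n)) sums S" by (auto dest: has_sum_imp_sums simp: o_def)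
qed (use assms in auto)

text \<open>Group the pairs by their product: the fibre over \<open>k\<close> is finite with
  \<open>d2 k\<close> elements, and the summand is constant on it. Summability over the pairs makes
  the regrouping legitimate.\<close>

lemma has_sum_d2_mult:
  fixes g :: "nat \<Rightarrow> real"
  assumes "(\<lambda>(a, b). g (a * b)) summable_on {1..} \<times> {1..}"
  shows "((\<lambda>k. real (d2 k) * g k) has_sum (\<Sum>\<^sub>\<infinity>(a, b)\<in>{1..} \<times> {1..}. g (a * b))) {1..}"
proof (rule has_sum_SigmaD)
  define D where "D = (\<lambda>k::nat. {(a, b). 0 < a \<and> 0 < b \<and> a * b = k})"
  have "bij_betw (\<lambda>(a, b). (a * b, (a, b))) ({1..} \<times> {1..}) (Sigma {1..} D)"
    by (rule bij_betwI[where g = snd]) (auto simp: D_def Suc_le_eq)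
  moreover have "((\<lambda>(a, b). g (a * b)) has_sum (\<Sum>\<^sub>\<infinity>(a, b)\<in>{1..} \<times> {1..}. g (a * b))) ({1..} \<times> {1..})"
    using assms by (rule has_sum_infsum)
  ultimately show "((\<lambda>(k, p). g k) has_sum (\<Sum>\<^sub>\<infinity>(a, b)\<in>{1..} \<times> {1..}. g (a * b))) (Sigma {1..} D)"
    by (subst has_sum_reindex_bij_betw [symmetric]) (auto simp: case_prod_unfold)
  show "((\<lambda>p. case (k, p) of (k, p) \<Rightarrow> g k) has_sum real (d2 k) * g k) (D k)" if "k \<in> {1..}" for k
  proof -
    have "D k \<subseteq> {..k} \<times> {..k}" by (auto simp: D_def)
    hence "finite (D k)" by (rule finite_subset) auto
    thus ?thesis by (intro has_sum_finiteI) (auto simp: D_def d2_def)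
  qed
qed

lemma inverse_square_has_sum: "((\<lambda>n. 1 / real n ^ 2) has_sum (pi\<^sup>2 / 6)) {1..}"
  using inverse_squares_sums by (intro has_sum_atLeast_1) (simp_all add: add.commute)

text \<open>The majorant splits as \<open>1 / (a b)^2 = (1 / a^2) (1 / b^2)\<close>. At
  \<open>k = 0\<close> the second hypothesis reads \<open>g 0 \<le> 0\<close>, as division by zero
  gives 0.\<close>

lemma summable_on_multiplicative:
  fixes g :: "nat \<Rightarrow> real"
  assumes "\<And>k. g k \<ge> 0" "\<And>k. g k \<le> C / real k ^ 2"
  shows "(\<lambda>(a, b). g (a * b)) summable_on {1..} \<times> {1..}"
proof (rule summable_on_comparison_test)
  show "(\<lambda>(a, b). C / real a ^ 2 * (1 / real b ^ 2)) summable_on {1..} \<times> {1..}"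
  proof (rule summable_on_SigmaI)
    show "((\<lambda>b. case (a, b) of (a, b) \<Rightarrow> C / real a ^ 2 * (1 / real b ^ 2)) has_sum C / real a ^ 2 * (pi\<^sup>2 / 6)) {1..}" for a
      using has_sum_cmult_right[OF inverse_square_has_sum, of "C / real a ^ 2"] by simp
    have "(\<lambda>a. C * (1 / real a ^ 2) * (pi\<^sup>2 / 6)) summable_on {1..}"
      using inverse_square_has_sum
      by (intro summable_on_cmult_left summable_on_cmult_right) (auto simp: summable_on_def)
    thus "(\<lambda>a. C / real a ^ 2 * (pi\<^sup>2 / 6)) summable_on {1..}" by simp
    have "0 \<le> C" using assms(1)[of 1] assms(2)[of 1] by simp
    thus "0 \<le> (case (a, b) of (a, b) \<Rightarrow> C / real a ^ 2 * (1 / real b ^ 2))" for a b by simp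
  qed
  show "(case p of (a, b) \<Rightarrow> g (a * b)) \<le> (case p of (a, b) \<Rightarrow> C / real a ^ 2 * (1 / real b ^ 2))" for p
    using assms(2)[of "fst p * snd p"] by (simp add: case_prod_unfold power_mult_distrib)
qed (use assms in auto)

text \<open>The second form of F makes the integrand a double series of Bessel integrals with
  \<open>A = pi n^2\<close> and \<open>B = (x m)^2\<close>. The prefactors combine to
  \<open>4 pi n^2 (x m) / (sqrt pi n) = 4 sqrt pi x m n\<close>, so that each term depends on the
  product \<open>m n\<close> alone.\<close>

lemma X1_cdf_theta_integral:
  assumes "x > 0"
  defines "g \<equiv> \<lambda>k. real k * bessel_K 1 (2 * x * real k * sqrt pi)"
  shows "(\<lambda>(a, b). g (a * b)) summable_on {1..} \<times> {1..}"
    and "(\<integral>\<^sup>+y\<in>{0<..}. ennreal (X1_cdf y * theta_sum 0 ((x * y)\<^sup>2)) \<partial>lborel) =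
      ennreal (4 * sqrt pi * x * (\<Sum>\<^sub>\<infinity>(a, b)\<in>{1..} \<times> {1..}. g (a * b)))"
proof -
  \<comment> \<open>At \<open>k = 0\<close> the Bessel argument is 0 and its value meaningless; the
    factor \<open>k\<close> removes it.\<close>
  have g0: "g k \<ge> 0" for k
    using bessel_K_1_nn_integral(2)[of "2 * x * real k * sqrt pi"] assms(1)
    by (cases "k = 0") (auto simp: g_def)
  have g_le: "g k \<le> (3 / (2 * x * sqrt pi)) ^ 3 / real k ^ 2" for k
  proof (cases "k = 0")
    case False
    hence "g k \<le> real k * (3 / (2 * x * real k * sqrt pi)) ^ 3"
      unfolding g_def using assms(1) by (intro mult_left_mono bessel_K_1_nn_integral(3)) auto
    also have "\<dots> = (3 / (2 * x * sqrt pi)) ^ 3 / real k ^ 2"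
      using False by (simp add: power_divide power_mult_distrib eval_nat_numeral)
    finally show ?thesis .
  qed (simp add: g_def)
  show sm: "(\<lambda>(a, b). g (a * b)) summable_on {1..} \<times> {1..}"
    by (rule summable_on_multiplicative[OF g0 g_le])
  define S where "S = (\<Sum>\<^sub>\<infinity>(a, b)\<in>{1..} \<times> {1..}. g (a * b))"
  define f where "f = (\<lambda>(m::nat) (n::nat) y.
      4 * pi * (real (Suc n))\<^sup>2 * (exp (- (pi * (real (Suc n))\<^sup>2 / y\<^sup>2) - (x * real (Suc m))\<^sup>2 * y\<^sup>2) / y ^ 3))"
  have f_int: "(\<integral>\<^sup>+y\<in>{0<..}. ennreal (f m n y) \<partial>lborel) = ennreal (4 * sqrt pi * x * g (Suc m * Suc n))" for m n
  proof -
    define M where "M = real (Suc m)"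
    define N where "N = real (Suc n)"
    have MN: "M > 0" "N > 0" by (simp_all add: M_def N_def)
    have "(\<integral>\<^sup>+y\<in>{0<..}. ennreal (f m n y) \<partial>lborel) =
       (\<integral>\<^sup>+y. ennreal (4 * pi * N\<^sup>2) * (ennreal (exp (- ((pi * N\<^sup>2) / y\<^sup>2) - (x * M)\<^sup>2 * y\<^sup>2) / y ^ 3) * indicator {0<..} y) \<partial>lborel)"
      unfolding f_def M_def [symmetric] N_def [symmetric]
      by (intro nn_integral_cong) (auto simp: indicator_def simp flip: ennreal_mult)
    also have "\<dots> = ennreal (4 * pi * N\<^sup>2) * ennreal (sqrt ((x * M)\<^sup>2 / (pi * N\<^sup>2)) * bessel_K 1 (2 * sqrt (pi * N\<^sup>2 * (x * M)\<^sup>2)))"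
      using assms(1) MN by (subst nn_integral_cmult) (auto simp: bessel_K_1_gaussian_integral)
    also have "2 * sqrt (pi * N\<^sup>2 * (x * M)\<^sup>2) = 2 * x * real (Suc m * Suc n) * sqrt pi"
      unfolding of_nat_mult M_def [symmetric] N_def [symmetric]
      using assms(1) MN by (simp add: real_sqrt_mult)
    also have "sqrt ((x * M)\<^sup>2 / (pi * N\<^sup>2)) = x * M / (sqrt pi * N)"
      using assms(1) MN by (simp add: real_sqrt_divide real_sqrt_mult)
    also have "ennreal (4 * pi * N\<^sup>2) * ennreal (x * M / (sqrt pi * N) * bessel_K 1 (2 * x * real (Suc m * Suc n) * sqrt pi)) =
        ennreal (4 * pi * N\<^sup>2 * (x * M / (sqrt pi * N) * bessel_K 1 (2 * x * real (Suc m * Suc n) * sqrt pi)))"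
      using MN by (subst ennreal_mult') auto
    also have "4 * pi * N\<^sup>2 * (x * M / (sqrt pi * N) * bessel_K 1 (2 * x * real (Suc m * Suc n) * sqrt pi)) =
        4 * sqrt pi * x * g (Suc m * Suc n)"
    proof -
      have "pi / sqrt pi = sqrt pi" by (simp add: real_div_sqrt)
      thus ?thesis
        using MN unfolding g_def of_nat_mult M_def [symmetric] N_def [symmetric]
        by (simp add: power2_eq_square field_simps)
    qed
    finally show ?thesis .
  qed
  have f0: "f m n y \<ge> 0" if "y > 0" for m n y
    using that by (simp add: f_def)
  have sums: "(\<Sum>m. \<Sum>n. ennreal (f m n y)) = ennreal (X1_cdf y * theta_sum 0 ((x * y)\<^sup>2))" if "y > 0" for y
  proof -
    have f_eq: "f m n y = 4 * pi / y ^ 3 * exp (- (real (Suc m))\<^sup>2 * (x * y)\<^sup>2) *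
        (real (Suc n) ^ (2 * 1) * exp (- (real (Suc n))\<^sup>2 * (pi / y\<^sup>2)))" for m n
      unfolding f_def by (simp add: power_mult_distrib power2_eq_square exp_diff exp_minus field_simps del: of_nat_Suc)
    have "(\<lambda>n. f m n y) sums (4 * pi / y ^ 3 * exp (- (real (Suc m))\<^sup>2 * (x * y)\<^sup>2) * theta_sum 1 (pi / y\<^sup>2))" for m
      unfolding f_eq theta_sum_def by (intro sums_mult summable_sums theta_summable) (use that in auto)
    hence "(\<Sum>n. ennreal (f m n y)) = ennreal (X1_cdf y * (real (Suc m) ^ (2 * 0) * exp (- (real (Suc m))\<^sup>2 * (x * y)\<^sup>2)))" for m
      using f0[OF that] that by (subst suminf_ennreal_eq) (auto simp: X1_cdf_eq mult_ac)
    moreover have "(\<lambda>m. X1_cdf y * (real (Suc m) ^ (2 * 0) * exp (- (real (Suc m))\<^sup>2 * (x * y)\<^sup>2))) sums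
       (X1_cdf y * theta_sum 0 ((x * y)\<^sup>2))"
      unfolding theta_sum_def by (intro sums_mult summable_sums theta_summable) (use that assms(1) in auto)
    moreover have "X1_cdf y \<ge> 0"
      using that theta_sum_pos[of "pi / y\<^sup>2" 1] by (simp add: X1_cdf_eq)
    ultimately show ?thesis
      by (simp only:) (intro suminf_ennreal_eq; simp)
  qed
  have [measurable]: "f m n \<in> borel_measurable borel" for m n
    unfolding f_def by measurable
  have "(\<integral>\<^sup>+y\<in>{0<..}. ennreal (X1_cdf y * theta_sum 0 ((x * y)\<^sup>2)) \<partial>lborel) =
      (\<integral>\<^sup>+y. (\<Sum>m. \<Sum>n. ennreal (f m n y) * indicator {0<..} y) \<partial>lborel)"
    by (intro nn_integral_cong) (auto simp: indicator_def sums)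
  \<comment> \<open>Nonnegativity allows both exchanges in \<open>ennreal\<close>; finiteness comes
    from the summability of \<open>g\<close> over pairs.\<close>
  also have "\<dots> = (\<Sum>m. \<integral>\<^sup>+y. (\<Sum>n. ennreal (f m n y) * indicator {0<..} y) \<partial>lborel)"
    by (rule nn_integral_suminf) measurable
  also have "\<dots> = (\<Sum>m. \<Sum>n. \<integral>\<^sup>+y\<in>{0<..}. ennreal (f m n y) \<partial>lborel)"
    by (intro suminf_cong nn_integral_suminf) measurable
  also have "\<dots> = (\<Sum>m. \<Sum>n. ennreal (4 * sqrt pi * x * g (Suc m * Suc n)))"
    by (simp only: f_int)
  also have "\<dots> = (\<Sum>m. ennreal (4 * sqrt pi * x * (\<Sum>\<^sub>\<infinity>b\<in>{1..}. g (Suc m * b))))"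
  proof (rule suminf_cong)
    fix m
    have "(\<lambda>b. g (Suc m * b)) summable_on {1..}"
      using summable_on_SigmaD1[OF sm, of "Suc m"] by simp
    thus "(\<Sum>n. ennreal (4 * sqrt pi * x * g (Suc m * Suc n))) = ennreal (4 * sqrt pi * x * (\<Sum>\<^sub>\<infinity>b\<in>{1..}. g (Suc m * b)))"
      using g0 assms(1) by (intro suminf_ennreal_atLeast_1 has_sum_cmult_right has_sum_infsum) auto
  qed
  also have "\<dots> = ennreal (4 * sqrt pi * x * S)"
  proof (rule suminf_ennreal_atLeast_1[of "\<lambda>a. 4 * sqrt pi * x * (\<Sum>\<^sub>\<infinity>b\<in>{1..}. g (a * b))"])
    have "((\<lambda>a. \<Sum>\<^sub>\<infinity>b\<in>{1..}. g (a * b)) has_sum S) {1..}"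
      unfolding S_def infsum_Sigma'_banach[OF sm, symmetric]
      using summable_on_Sigma_banach[OF sm] by (rule has_sum_infsum)
    thus "((\<lambda>a. 4 * sqrt pi * x * (\<Sum>\<^sub>\<infinity>b\<in>{1..}. g (a * b))) has_sum 4 * sqrt pi * x * S) {1..}"
      by (rule has_sum_cmult_right)
  qed (use g0 assms(1) in \<open>auto intro!: mult_nonneg_nonneg infsum_nonneg\<close>)
  finally show "(\<integral>\<^sup>+y\<in>{0<..}. ennreal (X1_cdf y * theta_sum 0 ((x * y)\<^sup>2)) \<partial>lborel) =
      ennreal (4 * sqrt pi * x * (\<Sum>\<^sub>\<infinity>(a, b)\<in>{1..} \<times> {1..}. g (a * b)))"
    by (simp only: S_def)
qed

theorem theorem1p3:
  fixes M :: "'a measure" and X1 :: "'a \<Rightarrow> real" and c x :: real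
  assumes "prob_space M"
    and "c > 1"
    and "distributed M lborel X1 (X1_density c)"
    and "x > 0"
  shows "(\<lambda>n. real (d2 n) * real n * bessel_K 1 (2 * x * real n * sqrt pi)) summable_on {1..} \<and>
    (\<forall>y>0. (\<lambda>n::nat. exp (- (x * real n * y)\<^sup>2)) summable_on {1..}) \<and>
    set_integrable lborel {0<..}
      (\<lambda>y. \<P>(\<omega> in M. X1 \<omega> \<le> y) * (\<Sum>\<^sub>\<infinity>n::nat\<in>{1..}. exp (- (x * real n * y)\<^sup>2))) \<and>
    x * (\<Sum>\<^sub>\<infinity>n\<in>{1..}. real (d2 n) * real n * bessel_K 1 (2 * x * real n * sqrt pi)) =
      1 / (4 * sqrt pi) *
        (LBINT y:{0<..}. \<P>(\<omega> in M. X1 \<omega> \<le> y) *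
          (\<Sum>\<^sub>\<infinity>n::nat\<in>{1..}. exp (- (x * real n * y)\<^sup>2)))"
proof -
  define g where "g = (\<lambda>k. real k * bessel_K 1 (2 * x * real k * sqrt pi))"
  define S where "S = (\<Sum>\<^sub>\<infinity>(a, b)\<in>{1..} \<times> {1..}. g (a * b))"
  have g0: "g k \<ge> 0" for k
    using bessel_K_1_nn_integral(2)[of "2 * x * real k * sqrt pi"] assms(4)
    by (cases "k = 0") (auto simp: g_def)
  have "((\<lambda>k. real (d2 k) * g k) has_sum S) {1..}"
    unfolding S_def g_def
    by (rule has_sum_d2_mult[OF X1_cdf_theta_integral(1)[OF assms(4)]])
  hence lhs: "((\<lambda>n. real (d2 n) * real n * bessel_K 1 (2 * x * real n * sqrt pi)) has_sum S) {1..}"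
    by (simp add: g_def mult.assoc)
  have theta: "((\<lambda>n::nat. exp (- (x * real n * y)\<^sup>2)) has_sum theta_sum 0 ((x * y)\<^sup>2)) {1..}" if "y > 0" for y
    using summable_sums[OF theta_summable[of "(x * y)\<^sup>2" 0]] that assms(4)
    by (intro has_sum_atLeast_1) (auto simp: theta_sum_def power_mult_distrib mult_ac)
  define h where "h = (\<lambda>y. indicator {0<..} y *\<^sub>R (X1_cdf y * theta_sum 0 ((x * y)\<^sup>2)))"
  \<comment> \<open>The indicator removes nonpositive \<open>y\<close>, so the formulas for the
    probability and the theta series are needed only where they were proved.\<close>
  have h_eq: "indicator {0<..} y *\<^sub>R (\<P>(\<omega> in M. X1 \<omega> \<le> y) * (\<Sum>\<^sub>\<infinity>n::nat\<in>{1..}. exp (- (x * real n * y)\<^sup>2))) = h y" for y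
    using prob_X1_le[OF assms(1-3)] infsumI[OF theta] by (auto simp: h_def indicator_def)
  have h0: "h y \<ge> 0" for y
    unfolding h_eq [symmetric] by (auto intro!: mult_nonneg_nonneg infsum_nonneg)
  have [measurable]: "theta_sum k \<in> borel_measurable borel" for k
    unfolding theta_sum_def [abs_def] by measurable
  have [measurable]: "h \<in> borel_measurable borel"
    unfolding h_def X1_cdf_def by measurable
  have "(\<integral>\<^sup>+y. ennreal (h y) \<partial>lborel) =
      (\<integral>\<^sup>+y\<in>{0<..}. ennreal (X1_cdf y * theta_sum 0 ((x * y)\<^sup>2)) \<partial>lborel)"
    by (intro nn_integral_cong) (auto simp: h_def indicator_def)
  also have "\<dots> = ennreal (4 * sqrt pi * x * S)"
    unfolding S_def g_def by (rule X1_cdf_theta_integral(2)[OF assms(4)])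
  \<comment> \<open>A nonnegative measurable function with finite \<open>ennreal\<close> integral is
    integrable with that value, so existence and evaluation of the right-hand side come in one
    step.\<close>
  finally have "integrable lborel h \<and> integral\<^sup>L lborel h = 4 * sqrt pi * x * S"
    using h0 g0 assms(4)
    by (subst nn_integral_eq_integrable [symmetric]) (auto simp: S_def intro!: mult_nonneg_nonneg infsum_nonneg)
  thus ?thesis
    using lhs theta unfolding set_integrable_def set_lebesgue_integral_def h_eq
    by (auto simp: summable_on_def infsumI)
qed

end
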